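(* If $z\in S_\infty$ is an involution that is dominant of shape $\lambda$, then \[\widehat{\mathcal{G}}_z=\prod_{\substack{(i,j)\in\mathsf D_\lambda\\ i=j}}x_i\prod_{\substack{(i,j)\in\mathsf D_\lambda\\ i<j}}(x_i+x_j+\beta x_ix_j).\]
   Context: $S_\infty$: permutations of $\mathbb{Z}$ fixing $i\le0$ and all but finitely many $i$; $\ell$ = number of inversions. Rothe diagram $D(w)=\{(i,j)\in\mathbb{Z}_{>0}^2:i<w^{-1}(j),\ j<w(i)\}$; for a partition $\lambda$, $\mathsf D_\lambda=\{(i,j):1\le j\le\lambda_i\}$; $w$ is dominant of shape $\lambda$ if $D(w)=\mathsf D_\lambda$. Grothendieck polynomials $\mathcal{G}^{(\beta)}_w$: $\mathcal{G}^{(\beta)}_{n\cdots21}=x_1^{n-1}\cdots x_{n-1}$, $\partial^{(\beta)}_i\mathcal{G}^{(\beta)}_w=\mathcal{G}^{(\beta)}_{ws_i}$ if $w(i)>w(i+1)$ else $-\beta\mathcal{G}^{(\beta)}_w$, where $\partial^{(\beta)}_if=\partial_i((1+\beta x_{i+1})f)$, $\partial_if=(f-s_if)/(x_i-x_{i+1})$. Demazure product $\circ$: associative, $s_i\circ w=s_iw$ if $\ell(s_iw)>\ell(w)$ else $w$. $\mathcal{B}_{\mathsf{inv}}(z)=\{w:w^{-1}\circ w=z\}$, $\ell_{\mathsf{inv}}(z)=(\ell(z)+|\{a>0:a<z(a)\}|)/2$, $\widehat{\mathcal{G}}_z=\sum_{w\in\mathcal{B}_{\mathsf{inv}}(z)}\beta^{\ell(w)-\ell_{\mathsf{inv}}(z)}\mathcal{G}^{(\beta)}_w$.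 *)

theory Defs
  imports "HOL-Library.Poly_Mapping" "HOL-Computational_Algebra.Polynomial"
    "HOL-Combinatorics.Permutations"
begin

section \<open>Permutations of the integers\<close>

definition S_inf :: "(int \<Rightarrow> int) set" where
  "S_inf = {w. w permutes {0<..} \<and> finite {i. w i \<noteq> i}}"

abbreviation adj :: "int \<Rightarrow> int \<Rightarrow> int" where
  "adj i \<equiv> transpose i (i + 1)"

definition len :: "(int \<Rightarrow> int) \<Rightarrow> nat" where
  "len w = card {(i, j). i < j \<and> w i > w j}"

definition longest :: "int \<Rightarrow> int \<Rightarrow> int" where
  "longest n i = (if 1 \<le> i \<and> i \<le> n then n + 1 - i else i)"

definition rothe_diagram :: "(int \<Rightarrow> int) \<Rightarrow> (int \<times> int) set" where
  "rothe_diagram w = {(i, j). 0 < i \<and> 0 < j \<and> i < inv w j \<and> j < w i}"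

text \<open>A partition is a function whose values at the positive integers are its parts; the
  values at the other integers are irrelevant.\<close>

definition is_partition :: "(int \<Rightarrow> nat) \<Rightarrow> bool" where
  "is_partition p \<longleftrightarrow> (\<forall>i>0. p (i + 1) \<le> p i) \<and> finite {i. 0 < i \<and> p i \<noteq> 0}"

definition diagram :: "(int \<Rightarrow> nat) \<Rightarrow> (int \<times> int) set" where
  "diagram p = {(i, j). 0 < i \<and> 1 \<le> j \<and> j \<le> int (p i)}"

definition dominant_of_shape :: "(int \<Rightarrow> int) \<Rightarrow> (int \<Rightarrow> nat) \<Rightarrow> bool" where
  "dominant_of_shape w p \<longleftrightarrow> is_partition p \<and> rothe_diagram w = diagram p"

section \<open>The polynomial ring and divided differences\<close>

text \<open>Polynomials over \<open>\<int>[\<beta>]\<close> in commuting variables \<open>x\<^sub>i\<close>, where \<open>\<int>[\<beta>]\<close> is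
  \<^typ>\<open>int poly\<close>. The variables are indexed by all integers to match the permutations,
  but only those with positive index occur below.\<close>

type_synonym pol = "(int \<Rightarrow>\<^sub>0 nat) \<Rightarrow>\<^sub>0 int poly"

definition X :: "int \<Rightarrow> pol" where
  "X i = Poly_Mapping.single (Poly_Mapping.single i 1) 1"

definition beta :: pol where
  "beta = Poly_Mapping.single 0 [:0, 1:]"

text \<open>\<^term>\<open>Poly_Mapping.map_key f p\<close> is composition of the coefficient function of \<open>p\<close> with the
  injection \<open>f\<close>. The inner use permutes the exponents of a monomial, the outer one
  the monomials of a polynomial; the result exchanges \<open>x\<^sub>i\<close> and \<open>x\<^bsub>i+1\<^esub>\<close>.\<close>

definition swap_vars :: "int \<Rightarrow> pol \<Rightarrow> pol" where
  "swap_vars i f = Poly_Mapping.map_key (Poly_Mapping.map_key (adj i)) f"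

text \<open>The quotient \<open>(f - s\<^sub>i f) / (x\<^sub>i - x\<^bsub>i+1\<^esub>)\<close> is a polynomial, and it is unique
  because \<^typ>\<open>pol\<close> is an integral domain.\<close>

definition divdiff :: "int \<Rightarrow> pol \<Rightarrow> pol" where
  "divdiff i f = (THE g. (X i - X (i + 1)) * g = f - swap_vars i f)"

definition divdiff_beta :: "int \<Rightarrow> pol \<Rightarrow> pol" where
  "divdiff_beta i f = divdiff i ((1 + beta * X (i + 1)) * f)"

section \<open>Grothendieck polynomials\<close>

definition grothendieck_family :: "((int \<Rightarrow> int) \<Rightarrow> pol) \<Rightarrow> bool" where
  "grothendieck_family G \<longleftrightarrow>
     (\<forall>n\<ge>1. G (longest n) = (\<Prod>i = 1..n - 1. X i ^ nat (n - i))) \<and>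
     (\<forall>w\<in>S_inf. \<forall>i>0. divdiff_beta i (G w) =
        (if w i > w (i + 1) then G (w \<circ> adj i) else - beta * G w))"

text \<open>The conditions determine the family on \<^const>\<open>S_inf\<close>: each of its elements is
  reached from some \<^term>\<open>longest n\<close> by steps from \<open>w\<close> to \<open>w s\<^sub>i\<close> at descents \<open>i\<close>. Values
  outside \<^const>\<open>S_inf\<close> are arbitrary and are never used.\<close>

definition grothendieck :: "(int \<Rightarrow> int) \<Rightarrow> pol" where
  "grothendieck = (SOME G. grothendieck_family G)"

section \<open>Demazure product and involution Grothendieck polynomials\<close>

definition is_demazure_product ::
  "((int \<Rightarrow> int) \<Rightarrow> (int \<Rightarrow> int) \<Rightarrow> (int \<Rightarrow> int)) \<Rightarrow> bool" where
  "is_demazure_product d \<longleftrightarrow>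
     (\<forall>u\<in>S_inf. \<forall>v\<in>S_inf. d u v \<in> S_inf) \<and>
     (\<forall>u\<in>S_inf. \<forall>v\<in>S_inf. \<forall>w\<in>S_inf. d (d u v) w = d u (d v w)) \<and>
     (\<forall>i>0. \<forall>w\<in>S_inf. d (adj i) w = (if len (adj i \<circ> w) > len w then adj i \<circ> w else w))"

text \<open>The conditions determine the product on \<^const>\<open>S_inf\<close>. They also force the identity
  to be neutral on the left: \<open>s\<^sub>i \<circ> (1 \<circ> w) = s\<^sub>i \<circ> w\<close> for all \<open>i\<close>, and for large \<open>i\<close> both
  sides are ordinary products. Values outside \<^const>\<open>S_inf\<close> are never used.\<close>

definition demazure :: "(int \<Rightarrow> int) \<Rightarrow> (int \<Rightarrow> int) \<Rightarrow> (int \<Rightarrow> int)" where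
  "demazure = (SOME d. is_demazure_product d)"

definition B_inv :: "(int \<Rightarrow> int) \<Rightarrow> (int \<Rightarrow> int) set" where
  "B_inv z = {w \<in> S_inf. demazure (inv w) w = z}"

text \<open>For an involution \<open>z\<close> in \<^const>\<open>S_inf\<close> the division is exact, and
  \<^term>\<open>len_inv z\<close> is the minimum of \<^const>\<open>len\<close> on \<^term>\<open>B_inv z\<close>, so the natural number
  subtraction in the exponent of \<open>\<beta>\<close> below never truncates.\<close>

definition len_inv :: "(int \<Rightarrow> int) \<Rightarrow> nat" where
  "len_inv z = (len z + card {a. 0 < a \<and> a < z a}) div 2"

definition inv_grothendieck :: "(int \<Rightarrow> int) \<Rightarrow> pol" where
  "inv_grothendieck z = (\<Sum>w\<in>B_inv z. beta ^ (len w - len_inv z) * grothendieck w)"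

end

theory Submission
  imports Defs
begin

text \<open>Let \<open>u\<^sub>i\<close> be the generators of the 0-Hecke algebra with \<open>u\<^sub>i\<^sup>2 = \<beta> u\<^sub>i\<close>, and put \<open>h\<^sub>i(x) = 1 + x u\<^sub>i\<close> and
  \<open>x \<oplus> y = x + y + \<beta> x y\<close>. By Fomin and Kirillov, the Grothendieck polynomial of \<open>w\<close> is the
  coefficient of \<open>u\<^sub>w\<close> in \<open>G = A\<^sub>1(x\<^sub>1) A\<^sub>2(x\<^sub>2) \<cdots>\<close> with \<open>A\<^sub>i(x) = h\<^bsub>n-1\<^esub>(x) \<cdots> h\<^sub>i(x)\<close>. The map
  \<open>w \<mapsto> w\<^sup>-\<^sup>1 \<circ> w\<close>, weighted by powers of \<open>\<beta>\<close>, is a homomorphism to a module with basis the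
  involutions, so the involution Grothendieck polynomial of \<open>z\<close> is the coefficient of \<open>z\<close> in \<open>1 \<cdot> G\<close>.
  There the reflection equation \<open>1 \<cdot> h\<^sub>i(x) h\<^bsub>i+1\<^esub>(x) = 1 \<cdot> h\<^bsub>i+1\<^esub>(x) h\<^sub>i(x)\<close> and the Yang--Baxter equation
  turn \<open>1 \<cdot> G\<close> into \<open>1\<close> times a product of factors \<open>h\<close>, one for each box \<open>i \<le> j\<close> of the staircase, with
  parameters \<open>x\<^sub>i\<close> for \<open>i = j\<close> and \<open>x\<^sub>i \<oplus> x\<^sub>j\<close> for \<open>i < j\<close>. The number of factors is the rank of the longest
  element, so the coefficient of that element is the product of all parameters. A dominant \<open>z\<close> other
  than the longest element has a first ascent \<open>k\<close>; passing to the next involution along \<open>k\<close> adds the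
  boxes \<open>(k, z(k))\<close> and \<open>(z(k), k)\<close> to the shape, and the \<open>k\<close>-th divided difference undoes this step on
  both sides of the formula.\<close>

section \<open>The polynomial ring\<close>

lemma inj_adj: "inj (adj i)" by (simp add: bij_is_inj)

text \<open>Exchanging two exponents twice restores a monomial. Injectivity lets the rules for
  \<open>map_key\<close> apply to the outer map in \<open>swap_vars\<close>.\<close>

lemma inj_map_key_adj: "inj (Poly_Mapping.map_key (adj i) :: (int \<Rightarrow>\<^sub>0 nat) \<Rightarrow> _)"
proof (rule inj_on_inverseI[where g = "Poly_Mapping.map_key (adj i)"])
  fix p :: "int \<Rightarrow>\<^sub>0 nat"
  show "Poly_Mapping.map_key (adj i) (Poly_Mapping.map_key (adj i) p) = p"
    by (simp add: map_key_compose[OF inj_adj inj_adj] map_key_id[unfolded id_def[symmetric]])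
qed

lemma swap_vars_single:
  "swap_vars i (Poly_Mapping.single k v) = Poly_Mapping.single (Poly_Mapping.map_key (adj i) k) v"
proof -
  have "Poly_Mapping.map_key (adj i) (Poly_Mapping.map_key (adj i) k) = k"
    by (simp add: map_key_compose[OF inj_adj inj_adj] map_key_id[unfolded id_def[symmetric]])
  then show ?thesis
    unfolding swap_vars_def using map_key_single[OF inj_map_key_adj, of i "Poly_Mapping.map_key (adj i) k" v]
    by simp
qed

lemma swap_vars_add: "swap_vars i (f + g) = swap_vars i f + swap_vars i g"
  unfolding swap_vars_def by (rule map_key_plus[OF inj_map_key_adj])

lemma swap_vars_0: "swap_vars i 0 = 0"
  unfolding swap_vars_def by (rule map_key_zero[OF inj_map_key_adj])

text \<open>Additive induction over single terms; it reduces the multiplicativity of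
  \<open>swap_vars\<close> to monomials.\<close>

lemma pol_induct [case_names zero single add]:
  fixes f :: pol
  assumes "P 0" "\<And>k v. P (Poly_Mapping.single k v)" "\<And>f g. P f \<Longrightarrow> P g \<Longrightarrow> P (f + g)"
  shows "P f"
proof (induction f rule: update_induct)
  case const then show ?case by (rule assms)
next
  case (update f a b)
  have "Poly_Mapping.update a b f = f + Poly_Mapping.single a b"
    using update(1) by (intro poly_mapping_eqI)
      (auto simp: lookup_update lookup_add lookup_single in_keys_iff)
  then show ?case using assms update by metis
qed

lemma swap_vars_mult: "swap_vars i (f * g) = swap_vars i f * swap_vars i g"
proof (induction f rule: pol_induct)
  case (single k v)
  show ?case
  proof (induction g rule: pol_induct)
    case (single l w)
    show ?case by (simp add: swap_vars_single mult_single map_key_plus[OF inj_adj])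
  qed (simp_all add: swap_vars_0 swap_vars_add distrib_left)
qed (simp_all add: swap_vars_0 swap_vars_add distrib_right)

lemma swap_vars_beta [simp]: "swap_vars i beta = beta"
  unfolding beta_def by (simp add: swap_vars_single map_key_zero[OF inj_adj])

lemma swap_vars_1 [simp]: "swap_vars i 1 = 1"
  using swap_vars_single[of i 0 1] by (simp add: map_key_zero[OF inj_adj])

lemma swap_vars_X [simp]: "swap_vars i (X j) = X (adj i j)"
proof -
  have "Poly_Mapping.map_key (adj i) (Poly_Mapping.single (adj i (adj i j)) 1)
      = Poly_Mapping.single (adj i j) (1 :: nat)"
    by (rule map_key_single[OF inj_adj])
  then show ?thesis by (simp add: X_def swap_vars_single)
qed

lemma swap_vars_power: "swap_vars i (f ^ k) = swap_vars i f ^ k"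
  by (induction k) (simp_all add: swap_vars_mult)

lemma swap_vars_sum: "swap_vars i (sum f A) = (\<Sum>a\<in>A. swap_vars i (f a))"
  by (induction A rule: infinite_finite_induct) (simp_all add: swap_vars_0 swap_vars_add)

lemma swap_vars_prod: "swap_vars i (prod f A) = (\<Prod>a\<in>A. swap_vars i (f a))"
  by (induction A rule: infinite_finite_induct) (simp_all add: swap_vars_mult)

text \<open>This makes the quotient defining \<open>divdiff\<close> unique and later allows the
  difference to be cancelled.\<close>

lemma X_diff_nonzero: "X i - X (i + 1) \<noteq> 0"
proof
  assume "X i - X (i + 1) = 0"
  then have "Poly_Mapping.lookup (X i) (Poly_Mapping.single i 1)
      = Poly_Mapping.lookup (X (i + 1)) (Poly_Mapping.single i 1)" by simp
  moreover have "Poly_Mapping.single (i + 1) (1 :: nat) \<noteq> Poly_Mapping.single i 1"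
    by (metis add_cancel_left_right lookup_single_eq lookup_single_not_eq zero_neq_one)
  ultimately show False by (simp add: X_def lookup_single)
qed

lemma divdiff_eqI:
  assumes "(X i - X (i + 1)) * g = f - swap_vars i f"
  shows "divdiff i f = g"
  unfolding divdiff_def using assms X_diff_nonzero[of i]
  by (intro the_equality) (auto simp flip: assms)

lemma divdiff_beta_eqI:
  assumes "(X i - X (i + 1)) * g = (1 + beta * X (i + 1)) * f - (1 + beta * X i) * swap_vars i f"
  shows "divdiff_beta i f = g"
  unfolding divdiff_beta_def using assms
  by (intro divdiff_eqI) (simp add: swap_vars_mult swap_vars_add)

section \<open>Permutations\<close>

lemma adj_adj_comp [simp]: "adj i \<circ> adj i = id"
  by (rule transpose_comp_involutory)

lemma comp_adj_adj [simp]: "w \<circ> adj i \<circ> adj i = w"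
  by (simp add: comp_assoc)

lemma adj_comp_adj [simp]: "adj i \<circ> (adj i \<circ> w) = w"
  by (simp add: comp_assoc[symmetric])

lemma S_inf_bij: "w \<in> S_inf \<Longrightarrow> bij w"
  unfolding S_inf_def by (auto dest: permutes_bij)

lemma S_inf_inj: "w \<in> S_inf \<Longrightarrow> w a = w b \<longleftrightarrow> a = b"
  using S_inf_bij bij_is_inj inj_eq by metis

lemma S_inf_pos: "w \<in> S_inf \<Longrightarrow> 0 < w a \<longleftrightarrow> 0 < a"
  unfolding S_inf_def by (auto dest: permutes_in_image)

lemma S_inf_id [simp]: "id \<in> S_inf"
  by (simp add: S_inf_def permutes_id)

lemma S_inf_adj [simp]: "0 < i \<Longrightarrow> adj i \<in> S_inf"
proof -
  assume "0 < i"
  moreover have "{j. adj i j \<noteq> j} \<subseteq> {i, i + 1}"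
    by (auto simp: transpose_def)
  ultimately show ?thesis
    unfolding S_inf_def by (auto intro: permutes_swap_id finite_subset)
qed

lemma S_inf_comp: assumes "u \<in> S_inf" "v \<in> S_inf" shows "u \<circ> v \<in> S_inf"
proof -
  have "{i. (u \<circ> v) i \<noteq> i} \<subseteq> {i. v i \<noteq> i} \<union> {i. u i \<noteq> i}"
    by auto
  with assms show ?thesis
    unfolding S_inf_def by (auto intro: permutes_compose finite_subset simp del: o_apply)
qed

lemma S_inf_inv: assumes "u \<in> S_inf" shows "inv u \<in> S_inf"
proof -
  have "{i. inv u i \<noteq> i} \<subseteq> {i. u i \<noteq> i}"
    using S_inf_bij[OF assms] by (auto simp: bij_is_inj inv_f_eq)
  with assms show ?thesis
    unfolding S_inf_def by (auto intro: permutes_inv finite_subset)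
qed

lemma S_inf_comp_adj_iff [simp]: "0 < i \<Longrightarrow> w \<circ> adj i \<in> S_inf \<longleftrightarrow> w \<in> S_inf"
  by (metis S_inf_adj S_inf_comp comp_adj_adj)

lemma S_inf_adj_comp_iff [simp]: "0 < i \<Longrightarrow> adj i \<circ> w \<in> S_inf \<longleftrightarrow> w \<in> S_inf"
  by (metis S_inf_adj S_inf_comp adj_comp_adj)

section \<open>Finite symmetric groups as stages of \<open>S_inf\<close>\<close>

definition S_fin :: "int \<Rightarrow> (int \<Rightarrow> int) set" where
  "S_fin n = {w. w permutes {1..n}}"

lemma finite_S_fin: "finite (S_fin n)"
  unfolding S_fin_def by (rule finite_permutations) simp

lemma S_fin_mono: "n \<le> m \<Longrightarrow> S_fin n \<subseteq> S_fin m"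
  unfolding S_fin_def by (auto intro: permutes_subset)

lemma S_fin_subset_S_inf: "S_fin n \<subseteq> S_inf"
proof
  fix w assume "w \<in> S_fin n"
  then have w: "w permutes {1..n}" by (simp add: S_fin_def)
  then have "{i. w i \<noteq> i} \<subseteq> {1..n}" by (auto simp: permutes_def)
  with w show "w \<in> S_inf"
    unfolding S_inf_def by (auto intro: permutes_subset finite_subset)
qed

lemma S_inf_in_S_fin:
  assumes "w \<in> S_inf" obtains n where "1 \<le> n" "w \<in> S_fin n"
proof -
  have w: "w permutes {0<..}" and "finite {i. w i \<noteq> i}"
    using assms by (auto simp: S_inf_def)
  then have f: "finite (insert 1 {i. w i \<noteq> i})" by simp
  define n where "n = Max (insert 1 {i. w i \<noteq> i})"
  have ge: "i \<le> n" if "w i \<noteq> i" for i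
    unfolding n_def using f that by (intro Max_ge) auto
  have "1 \<le> n" unfolding n_def using f by (intro Max_ge) auto
  moreover have "w permutes {1..n}"
  proof (rule permutes_superset[OF w])
    fix i assume "i \<in> {0<..} - {1..n}"
    then show "w i = i" using ge[of i] by auto
  qed
  ultimately show thesis using that by (auto simp: S_fin_def)
qed

lemma S_fin_adj: "0 < i \<Longrightarrow> i < n \<Longrightarrow> adj i \<in> S_fin n"
  unfolding S_fin_def by (auto intro!: permutes_swap_id)

lemma S_fin_comp: "u \<in> S_fin n \<Longrightarrow> v \<in> S_fin n \<Longrightarrow> u \<circ> v \<in> S_fin n"
  unfolding S_fin_def by (auto intro: permutes_compose)

lemma S_fin_comp_adj_iff: "0 < i \<Longrightarrow> i < n \<Longrightarrow> w \<circ> adj i \<in> S_fin n \<longleftrightarrow> w \<in> S_fin n"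
  by (metis S_fin_adj S_fin_comp comp_adj_adj)

lemma S_fin_range: "w \<in> S_fin n \<Longrightarrow> a \<in> {1..n} \<Longrightarrow> w a \<in> {1..n}"
  unfolding S_fin_def by (metis mem_Collect_eq permutes_in_image)

lemma S_fin_fix: "w \<in> S_fin n \<Longrightarrow> a \<notin> {1..n} \<Longrightarrow> w a = a"
  unfolding S_fin_def by (auto simp: permutes_def)

lemma longest_S_fin: "longest n \<in> S_fin n"
  unfolding S_fin_def mem_Collect_eq
  by (rule bij_imp_permutes, rule bij_betw_byWitness[where f' = "longest n"])
    (auto simp: longest_def)

section \<open>Inversions, descents and ascents\<close>

lemma finite_inversions: assumes "w \<in> S_inf" shows "finite {(i, j). i < j \<and> w i > w j}"
proof -
  obtain n where n: "w \<in> S_fin n" using S_inf_in_S_fin assms by blast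
  have "{(i, j). i < j \<and> w i > w j} \<subseteq> {1..n} \<times> {1..n}"
    using S_fin_range[OF n] S_fin_fix[OF n]
    by (clarsimp simp: subset_iff) (smt (verit, best))
  then show ?thesis by (rule finite_subset) simp
qed

lemma len_id [simp]: "len id = 0"
  unfolding len_def by (auto intro!: card_eq_0_iff[THEN iffD2])

lemma adj_apply: "adj i j = (if j = i then i + 1 else if j = i + 1 then i else j)"
  by (simp add: transpose_def)

text \<open>Applying \<open>adj i\<close> to both positions carries the inversions of
  \<open>w\<close> to those of \<open>w \<circ> adj i\<close> other than the new one
  \<open>(i, i + 1)\<close>.\<close>

lemma len_comp_adj:
  assumes "w \<in> S_inf" "w i < w (i + 1)"
  shows "len (w \<circ> adj i) = Suc (len w)"
proof -
  let ?I = "\<lambda>w :: int \<Rightarrow> int. {(a, b). a < b \<and> w a > w b}"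
  let ?s = "map_prod (adj i) (adj i)"
  have "?I (w \<circ> adj i) = insert (i, i + 1) (?s ` ?I w)"
  proof (intro equalityI subsetI)
    fix x assume x: "x \<in> ?I (w \<circ> adj i)"
    obtain a b where ab: "x = (a, b)" by (cases x)
    have "x = ?s (adj i a, adj i b)" by (simp add: ab)
    moreover have "(adj i a, adj i b) \<in> ?I w \<or> x = (i, i + 1)"
      using x assms unfolding ab by (auto simp: adj_apply split: if_splits)
    ultimately show "x \<in> insert (i, i + 1) (?s ` ?I w)" by blast
  next
    fix x assume "x \<in> insert (i, i + 1) (?s ` ?I w)"
    then show "x \<in> ?I (w \<circ> adj i)"
      using assms by (auto simp: adj_apply split: if_splits)
  qed
  moreover have "(i, i + 1) \<notin> ?s ` ?I w"
    by (auto simp: adj_apply split: if_splits)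
  moreover have "card (?s ` ?I w) = card (?I w)"
    by (intro card_image inj_on_subset[OF prod.inj_map] inj_adj) simp
  ultimately show ?thesis
    unfolding len_def using finite_inversions[OF assms(1)] by simp
qed

lemma len_comp_adj_desc:
  assumes "w \<in> S_inf" "0 < i" "w i > w (i + 1)"
  shows "len w = Suc (len (w \<circ> adj i))"
proof -
  have "len (w \<circ> adj i \<circ> adj i) = Suc (len (w \<circ> adj i))"
    using assms by (intro len_comp_adj) (simp_all add: adj_apply)
  then show ?thesis by simp
qed

lemma len_inv_perm: assumes "w \<in> S_inf" shows "len (inv w) = len w"
  unfolding len_def
proof (rule bij_betw_same_card)
  have b: "bij w" using assms by (rule S_inf_bij)
  note s = bij_is_inj[OF b, THEN inv_f_f] bij_is_surj[OF b, THEN surj_f_inv_f]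
  show "bij_betw (\<lambda>(a, b). (inv w b, inv w a))
      {(i, j). i < j \<and> inv w j < inv w i} {(i, j). i < j \<and> w j < w i}"
    by (rule bij_betw_byWitness[where f' = "\<lambda>(a, b). (w b, w a)"]) (auto simp: s)
qed

lemma inv_comp_adj: "w \<in> S_inf \<Longrightarrow> inv (w \<circ> adj i) = adj i \<circ> inv w"
  by (subst o_inv_distrib) (auto intro: S_inf_bij)

lemma inv_adj_comp: "w \<in> S_inf \<Longrightarrow> inv (adj i \<circ> w) = inv w \<circ> adj i"
  by (subst o_inv_distrib) (auto intro: S_inf_bij)

lemma inv_inv_S_inf: "w \<in> S_inf \<Longrightarrow> inv (inv w) = w"
  by (simp add: inv_inv_eq S_inf_bij)

lemma len_adj_comp_less_iff:
  assumes "w \<in> S_inf" "0 < i"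
  shows "len (adj i \<circ> w) > len w \<longleftrightarrow> inv w i < inv w (i + 1)"
proof -
  have "len (adj i \<circ> w) = len (inv w \<circ> adj i)"
    using len_inv_perm[of "adj i \<circ> w"] assms by (simp add: inv_adj_comp)
  moreover have "len w = len (inv w)" using len_inv_perm assms by simp
  moreover have "inv w i \<noteq> inv w (i + 1)"
    using S_inf_inj[OF S_inf_inv[OF assms(1)]] by simp
  ultimately show ?thesis
    using len_comp_adj[of "inv w" i] len_comp_adj_desc[of "inv w" i] assms S_inf_inv
    by (cases "inv w i < inv w (i + 1)") (auto simp: not_less)
qed

text \<open>Integer values rise by at least 1 at each ascent. Applied from both ends of an interval,
  this pins a monotone permutation down; decreasing ones are treated by negation.\<close>

lemma strict_asc_mono:
  fixes w :: "int \<Rightarrow> int"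
  assumes "\<And>i. a \<le> i \<Longrightarrow> i < n \<Longrightarrow> w i < w (i + 1)" "a \<le> b" "b \<le> n"
  shows "w a + (b - a) \<le> w b"
  using assms(2,3)
proof (induction b rule: int_ge_induct)
  case (step i)
  then show ?case using assms(1)[of i] by auto
qed simp

lemma S_inf_exists_desc:
  assumes "w \<in> S_inf" "w \<noteq> id"
  obtains i where "0 < i" "w i > w (i + 1)"
proof (rule ccontr)
  note found = that
  assume "\<not> thesis"
  then have "\<not> w i > w (i + 1)" if "0 < i" for i using that found \<open>\<not> thesis\<close> by blast
  then have asc: "w i < w (i + 1)" if "0 < i" for i
    using that S_inf_inj[OF assms(1), of i "i + 1"] by (metis linorder_neqE not_less_iff_gr_or_eq less_add_same_cancel1 add_cancel_left_right zero_neq_one)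
  obtain n where n: "1 \<le> n" "w \<in> S_fin n" using S_inf_in_S_fin assms by blast
  have "w a = a" if "1 \<le> a" "a \<le> n" for a
  proof -
    have "w 1 + (a - 1) \<le> w a" using asc that by (intro strict_asc_mono[where n = n]) auto
    moreover have "w a + (n - a) \<le> w n" using asc that by (intro strict_asc_mono[where n = n]) auto
    moreover have "1 \<le> w 1" "w n \<le> n" using S_fin_range[OF n(2), of 1] S_fin_range[OF n(2), of n] n by auto
    ultimately show ?thesis by simp
  qed
  then have "w = id" using S_fin_fix[OF n(2)] by (auto simp: fun_eq_iff)
  with assms show False by simp
qed

lemma S_fin_exists_asc:
  assumes "w \<in> S_fin n" "w \<noteq> longest n"
  obtains i where "0 < i" "i < n" "w i < w (i + 1)"
proof (rule ccontr)
  note found = that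
  assume "\<not> thesis"
  then have "\<not> w i < w (i + 1)" if "0 < i" "i < n" for i using that found \<open>\<not> thesis\<close> by blast
  moreover have "w i \<noteq> w (i + 1)" for i
    using S_inf_inj[of w i "i + 1"] assms S_fin_subset_S_inf by auto
  ultimately have desc: "- w i < - w (i + 1)" if "0 < i" "i < n" for i
    using that by (metis linorder_neqE neg_less_iff_less)
  have "w a = n + 1 - a" if "1 \<le> a" "a \<le> n" for a
  proof -
    have "- w 1 + (a - 1) \<le> - w a" using desc that
      by (intro strict_asc_mono[where n = n and w = "\<lambda>a. - w a"]) auto
    moreover have "- w a + (n - a) \<le> - w n" using desc that
      by (intro strict_asc_mono[where n = n and w = "\<lambda>a. - w a"]) auto
    moreover have "1 \<le> w n" "w 1 \<le> n"
      using S_fin_range[OF assms(1), of 1] S_fin_range[OF assms(1), of n] that by auto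
    ultimately show ?thesis by simp
  qed
  then have "w = longest n" using S_fin_fix[OF assms(1)] by (auto simp: fun_eq_iff longest_def)
  with assms show False by simp
qed

section \<open>Modules over the 0-Hecke algebra\<close>

definition oplus :: "pol \<Rightarrow> pol \<Rightarrow> pol" where
  "oplus x y = x + y + beta * x * y"

lemma oplus_commute: "oplus x y = oplus y x"
  by (simp add: oplus_def algebra_simps)

text \<open>A set graded by \<open>ell\<close> with an involution \<open>c i\<close> for each \<open>i\<close> that toggles the descent at \<open>i\<close> carries a right
  action of the generators \<open>u\<^sub>i\<close> with \<open>u\<^sub>i\<^sup>2 = \<beta> u\<^sub>i\<close>. Below \<open>U i\<close> is \<open>u\<^sub>i\<close> on coefficient functions, \<open>K i a b\<close>
  is \<open>a + b u\<^sub>i\<close>, \<open>H i x\<close> is \<open>h\<^sub>i(x) = 1 + x u\<^sub>i\<close>, and \<open>act\<close> multiplies by the factors \<open>h\<^sub>i(x)\<close> of a list,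
  the head of the list acting first. The braid
  relations are not consequences of these axioms; they are proved for permutations only.\<close>

locale graded_involutions =
  fixes \<Omega> :: "'w set" and c :: "int \<Rightarrow> 'w \<Rightarrow> 'w" and desc :: "int \<Rightarrow> 'w \<Rightarrow> bool"
    and ell :: "'w \<Rightarrow> nat" and e :: 'w
  assumes c_closed: "0 < i \<Longrightarrow> z \<in> \<Omega> \<Longrightarrow> c i z \<in> \<Omega>"
    and c_c: "0 < i \<Longrightarrow> z \<in> \<Omega> \<Longrightarrow> c i (c i z) = z"
    and desc_c: "0 < i \<Longrightarrow> z \<in> \<Omega> \<Longrightarrow> desc i (c i z) \<longleftrightarrow> \<not> desc i z"
    and ell_c: "0 < i \<Longrightarrow> z \<in> \<Omega> \<Longrightarrow> \<not> desc i z \<Longrightarrow> ell (c i z) = Suc (ell z)"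
    and e_in: "e \<in> \<Omega>" and ell_e: "ell e = 0"
begin

definition U :: "int \<Rightarrow> ('w \<Rightarrow> pol) \<Rightarrow> 'w \<Rightarrow> pol" where
  "U i m z = (if 0 < i \<and> z \<in> \<Omega> \<and> desc i z then beta * m z + m (c i z) else 0)"

definition K :: "int \<Rightarrow> pol \<Rightarrow> pol \<Rightarrow> ('w \<Rightarrow> pol) \<Rightarrow> 'w \<Rightarrow> pol" where
  "K i a b m z = a * m z + b * U i m z"

definition H :: "int \<Rightarrow> pol \<Rightarrow> ('w \<Rightarrow> pol) \<Rightarrow> 'w \<Rightarrow> pol" where
  "H i x = K i 1 x"

definition act :: "(int \<times> pol) list \<Rightarrow> ('w \<Rightarrow> pol) \<Rightarrow> 'w \<Rightarrow> pol" where
  "act = fold (\<lambda>(i, x). H i x)"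

definition walk :: "int list \<Rightarrow> 'w" where
  "walk L = fold c L e"

definition unit :: "'w \<Rightarrow> pol" where
  "unit z = (if z = e then 1 else 0)"

lemma act_simps [simp]: "act [] m = m" "act ((i, x) # L) m = act L (H i x m)"
  by (simp_all add: act_def)

lemma act_append [simp]: "act (L @ L') m = act L' (act L m)"
  by (simp add: act_def)

lemma walk_snoc: "walk (L @ [i]) = c i (walk L)"
  by (simp add: walk_def)

text \<open>At a descent \<open>z\<close> the partner \<open>c i z\<close> has no descent at
  \<open>i\<close>, so its coefficient in \<open>U i m\<close> vanishes.\<close>

lemma U_U: "U i (U i m) z = beta * U i m z"
  using desc_c[of i z] by (auto simp: U_def)

lemma U_add: "U i (\<lambda>z. m z + m' z) z = U i m z + U i m' z"
  by (simp add: U_def algebra_simps)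

lemma U_scale: "U i (\<lambda>z. a * m z) z = a * U i m z"
  by (simp add: U_def algebra_simps)

lemma K_eq: "K i a b m = (\<lambda>z. a * m z + b * U i m z)"
  by (simp add: fun_eq_iff K_def)

text \<open>The mixed term \<open>x y u_i^2\<close> equals \<open>beta x y u_i\<close>; hence
  parameters of equal generators add by the formal group law.\<close>

lemma H_H: "H i y (H i x m) = H i (oplus x y) m"
  by (rule ext) (simp add: H_def K_eq U_add U_scale U_U oplus_def, simp add: algebra_simps)

lemma K_H: "K i (1 + beta * x) (y - x) (H i x m) = (\<lambda>z. (1 + beta * x) * H i y m z)"
  by (rule ext) (simp add: H_def K_eq U_add U_scale U_U, simp add: algebra_simps)

lemma H_scale: "H i x (\<lambda>z. a * m z) = (\<lambda>z. a * H i x m z)"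
  by (simp add: H_def K_eq U_scale algebra_simps)

lemma act_scale: "act L (\<lambda>z. a * m z) = (\<lambda>z. a * act L m z)"
  by (induction L arbitrary: m) (auto simp: H_scale)

lemma ell_c_le: "0 < i \<Longrightarrow> z \<in> \<Omega> \<Longrightarrow> ell z \<le> Suc (ell (c i z))"
  by (metis c_c c_closed desc_c ell_c le_SucI le_refl nat_le_linear Suc_n_not_le_n)

text \<open>Each factor raises the grade by at most one, starting from grade 0.\<close>

lemma act_unit_vanish:
  "length L < ell z \<Longrightarrow> act L unit z = 0"
proof (induction L arbitrary: z rule: rev_induct)
  case Nil
  then show ?case using ell_e by (auto simp: unit_def)
next
  case (snoc p L)
  obtain i x where p: "p = (i, x)" by (cases p)
  have "act L unit (c i z) = 0" if "0 < i" "z \<in> \<Omega>"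
    using snoc ell_c_le[OF that] by auto
  with snoc show ?case by (simp add: p H_def K_def U_def)
qed

lemma walk_in: "\<forall>i\<in>set L. 0 < i \<Longrightarrow> walk L \<in> \<Omega>"
  by (induction L rule: rev_induct) (auto simp: walk_snoc c_closed, simp add: walk_def e_in)

text \<open>An element whose grade equals the number of factors is reached only by choosing the term
  \<open>x u_i\<close> in every factor, each time at an ascent. Thus a single product of parameters
  survives.\<close>

lemma act_unit_walk:
  assumes "\<forall>(i, x)\<in>set L. 0 < i"
  shows "ell (walk (map fst L)) \<le> length L \<and>
    (ell (walk (map fst L)) = length L \<longrightarrow>
      act L unit (walk (map fst L)) = prod_list (map snd L))"
  using assms
proof (induction L rule: rev_induct)
  case Nil
  then show ?case using ell_e by (auto simp: unit_def walk_def)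
next
  case (snoc p L)
  obtain i x where p: "p = (i, x)" by (cases p)
  let ?v = "walk (map fst L)"
  from snoc have i: "0 < i" and L: "\<forall>(i, x)\<in>set L. 0 < i"
    and IH: "ell ?v \<le> length L" "ell ?v = length L \<longrightarrow> act L unit ?v = prod_list (map snd L)"
    by (auto simp: p)
  have v: "?v \<in> \<Omega>" using L by (intro walk_in) auto
  have w: "walk (map fst (L @ [p])) = c i ?v" by (simp add: p walk_snoc)
  show ?case
  proof (cases "desc i ?v")
    case True
    then have "\<not> desc i (c i ?v)" using desc_c i v by simp
    then have "ell ?v = Suc (ell (c i ?v))" using ell_c[of i "c i ?v"] c_closed c_c i v by simp
    then show ?thesis using IH unfolding w by simp
  next
    case False
    have "ell (c i ?v) = Suc (ell ?v)" using ell_c[OF i v False] .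
    moreover have "act (L @ [p]) unit (c i ?v) = prod_list (map snd (L @ [p]))"
      if "ell ?v = length L"
    proof -
      \<comment> \<open>The constant term of the last factor and the \<open>beta\<close> term of
        \<open>U\<close> both carry this coefficient; only the step up from \<open>?v\<close>
        remains.\<close>
      have "act L unit (c i ?v) = 0"
        using that \<open>ell (c i ?v) = Suc (ell ?v)\<close> by (intro act_unit_vanish) simp
      then show ?thesis
        using that IH desc_c[OF i v] c_c[OF i v] c_closed[OF i v] i False
        by (simp add: p H_def K_def U_def)
    qed
    ultimately show ?thesis using IH unfolding w by simp
  qed
qed

end

text \<open>\<open>row n a x\<close> is \<open>A\<^sub>a(x) = h\<^bsub>n-1\<^esub>(x) \<cdots> h\<^sub>a(x)\<close>, and \<open>rows n a y\<close> is
  \<open>A\<^sub>a(y\<^sub>a) A\<^bsub>a+1\<^esub>(y\<^bsub>a+1\<^esub>) \<cdots>\<close>; for \<open>a = 1\<close> and \<open>y = X\<close> this is the Fomin--Kirillov product.\<close>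

definition row :: "int \<Rightarrow> int \<Rightarrow> pol \<Rightarrow> (int \<times> pol) list" where
  "row n a x = map (\<lambda>j. (j, x)) (rev [a..n - 1])"

text \<open>The factors of \<open>row\<close> in the opposite order, the form that a row takes after
  repeated use of the reflection equation.\<close>

definition row_rev :: "int \<Rightarrow> int \<Rightarrow> pol \<Rightarrow> (int \<times> pol) list" where
  "row_rev n a x = map (\<lambda>j. (j, x)) [a..n - 1]"

definition rows :: "int \<Rightarrow> int \<Rightarrow> (int \<Rightarrow> pol) \<Rightarrow> (int \<times> pol) list" where
  "rows n a y = concat (map (\<lambda>k. row n k (y k)) [a..n])"

lemma row_Nil [simp]: "n \<le> a \<Longrightarrow> row n a x = []"
  by (simp add: row_def)

lemma row_rev_Nil [simp]: "n \<le> a \<Longrightarrow> row_rev n a x = []"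
  by (simp add: row_rev_def)

lemma rows_Nil [simp]: "n \<le> a \<Longrightarrow> rows n a x = []"
  by (cases "n = a") (simp_all add: rows_def)

lemma row_rec: "a < n \<Longrightarrow> row n a x = row n (a + 1) x @ [(a, x)]"
  by (simp add: row_def upto_rec1[of a])

lemma row_rev_rec: "a < n \<Longrightarrow> row_rev n a x = (a, x) # row_rev n (a + 1) x"
  by (simp add: row_rev_def upto_rec1[of a])

lemma rows_rec: "a < n \<Longrightarrow> rows n a y = row n a (y a) @ rows n (a + 1) y"
  by (simp add: rows_def upto_rec1[of a])

lemma set_row: "(j, z) \<in> set (row n a x) \<Longrightarrow> a \<le> j \<and> j < n \<and> z = x"
  by (auto simp: row_def)

lemma set_row_rev: "(j, z) \<in> set (row_rev n a x) \<Longrightarrow> a \<le> j \<and> j < n \<and> z = x"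
  by (auto simp: row_rev_def)

lemma set_rows: "(j, z) \<in> set (rows n a y) \<Longrightarrow> a \<le> j \<and> j < n"
  by (auto simp: rows_def dest: set_row)

section \<open>The right regular module on permutations and its braid relations\<close>

definition rmul :: "int \<Rightarrow> (int \<Rightarrow> int) \<Rightarrow> int \<Rightarrow> int" where
  "rmul i w = w \<circ> adj i"

definition rdesc :: "int \<Rightarrow> (int \<Rightarrow> int) \<Rightarrow> bool" where
  "rdesc i w \<longleftrightarrow> w i > w (i + 1)"

interpretation R: graded_involutions S_inf rmul rdesc len id
proof
  fix i :: int and w :: "int \<Rightarrow> int"
  assume i: "0 < i" and w: "w \<in> S_inf"
  have ne: "w i \<noteq> w (i + 1)" using S_inf_inj[OF w] by simp
  show "rmul i w \<in> S_inf" "rmul i (rmul i w) = w"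
    using i w by (simp_all add: rmul_def)
  show "rdesc i (rmul i w) \<longleftrightarrow> \<not> rdesc i w"
    using ne by (auto simp: rmul_def rdesc_def adj_apply)
  show "len (rmul i w) = Suc (len w)" if "\<not> rdesc i w"
    using ne that w unfolding rmul_def rdesc_def by (intro len_comp_adj) auto
qed auto

lemma adj_commute: "i + 1 < j \<or> j + 1 < i \<Longrightarrow> adj i \<circ> adj j = adj j \<circ> adj i"
  by (auto simp: fun_eq_iff adj_apply)

lemma adj_braid: "adj i \<circ> adj (i + 1) \<circ> adj i = adj (i + 1) \<circ> adj i \<circ> adj (i + 1)"
proof
  fix x
  consider "x = i" | "x = i + 1" | "x = i + 2" | "x \<noteq> i" "x \<noteq> i + 1" "x \<noteq> i + 2" by blast
  then show "(adj i \<circ> adj (i + 1) \<circ> adj i) x = (adj (i + 1) \<circ> adj i \<circ> adj (i + 1)) x"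
    by cases (simp_all only: o_apply adj_apply, simp_all)
qed

lemma U_commute:
  assumes "i + 1 < j \<or> j + 1 < i"
  shows "R.U i (R.U j m) w = R.U j (R.U i m) w"
proof (cases "0 < i \<and> 0 < j \<and> w \<in> S_inf")
  case True
  define s t where "s = adj i" and "t = adj j"
  have st: "w \<circ> s \<circ> t = w \<circ> t \<circ> s"
    using adj_commute[OF assms] by (simp add: comp_assoc s_def t_def)
  have v: "t i = i" "t (i + 1) = i + 1" "s j = j" "s (j + 1) = j + 1"
    using assms by (auto simp: s_def t_def adj_apply)
  have in_S: "w \<circ> s \<in> S_inf" "w \<circ> t \<in> S_inf"
    using True by (auto simp: s_def t_def)
  have Ui: "R.U i m w = (if w \<in> S_inf \<and> w i > w (i + 1) then beta * m w + m (w \<circ> s) else 0)"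
    and Uj: "R.U j m w = (if w \<in> S_inf \<and> w j > w (j + 1) then beta * m w + m (w \<circ> t) else 0)"
    for m w
    using True by (auto simp: R.U_def rmul_def rdesc_def s_def t_def)
  show ?thesis
    using True in_S by (simp add: Ui Uj v st distrib_left)
qed (auto simp: R.U_def)

lemma U_braid:
  assumes "0 < i"
  shows "R.U i (R.U (i + 1) (R.U i m)) w = R.U (i + 1) (R.U i (R.U (i + 1) m)) w"
proof (cases "w \<in> S_inf")
  case True
  define s t j k where "s = adj i" and "t = adj (i + 1)" and "j = i + 1" and "k = i + 2"
  have br: "w \<circ> t \<circ> s \<circ> t = w \<circ> s \<circ> t \<circ> s"
    using adj_braid[of i] by (simp add: comp_assoc s_def t_def)
  have ne: "w i \<noteq> w j" "w i \<noteq> w k" "w j \<noteq> w k"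
    using S_inf_inj[OF True] by (simp_all add: j_def k_def)
  have v: "s i = j" "s j = i" "s k = k" "t i = i" "t j = k" "t k = j"
    by (auto simp: s_def t_def j_def k_def transpose_def)
  have in_S: "w' \<circ> s \<in> S_inf" "w' \<circ> t \<in> S_inf" if "w' \<in> S_inf" for w'
    using assms that unfolding s_def t_def by (intro S_inf_comp S_inf_adj; simp)+
  have Ui: "R.U i m w = (if w \<in> S_inf \<and> w i > w j then beta * m w + m (w \<circ> s) else 0)"
    and Uj: "R.U j m w = (if w \<in> S_inf \<and> w j > w k then beta * m w + m (w \<circ> t) else 0)"
    for m w
    using assms by (auto simp: R.U_def rmul_def rdesc_def s_def t_def j_def k_def add.assoc)
  \<comment> \<open>All descents involved depend only on the relative order of three consecutive
    values of \<open>w\<close>.\<close>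
  consider "w i < w j" "w j < w k" | "w i < w k" "w k < w j"
    | "w j < w i" "w i < w k" | "w j < w k" "w k < w i"
    | "w k < w i" "w i < w j" | "w k < w j" "w j < w i"
    using ne by linarith
  then show ?thesis
    unfolding j_def[symmetric] using True by cases (simp_all add: Ui Uj v in_S br distrib_left ac_simps)
qed (simp add: R.U_def)

lemma K_commute:
  assumes "i + 1 < j \<or> j + 1 < i"
  shows "R.K i a b (R.K j a' b' m) = R.K j a' b' (R.K i a b m)"
  using U_commute[OF assms]
  by (intro ext) (simp add: R.K_eq R.U_add R.U_scale, simp add: algebra_simps)

lemma act_K:
  assumes "\<And>j z. (j, z) \<in> set L \<Longrightarrow> i + 1 < j \<or> j + 1 < i"
  shows "R.act L (R.K i a b m) = R.K i a b (R.act L m)"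
  using assms
proof (induction L arbitrary: m)
  case (Cons p L)
  obtain j x where p: "p = (j, x)" by (cases p)
  have "i + 1 < j \<or> j + 1 < i" using Cons.prems[of j x] by (simp add: p)
  then have "R.H j x (R.K i a b m) = R.K i a b (R.H j x m)"
    unfolding R.H_def by (intro K_commute) auto
  moreover have "R.act L (R.K i a b (R.H j x m)) = R.K i a b (R.act L (R.H j x m))"
    using Cons.prems by (intro Cons.IH) auto
  ultimately show ?case by (simp add: p)
qed simp

lemma act_H:
  assumes "\<And>j z. (j, z) \<in> set L \<Longrightarrow> i + 1 < j \<or> j + 1 < i"
  shows "R.act L (R.H i x m) = R.H i x (R.act L m)"
  unfolding R.H_def using assms by (rule act_K)

text \<open>After expansion \<open>U_braid\<close> matches the cubic terms, and the quadratic
  relation matches the rest because the middle parameter is the formal sum of the outer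
  ones.\<close>

lemma yang_baxter:
  assumes "0 < i"
  shows "R.H i y (R.H (i + 1) (oplus x y) (R.H i x m)) =
    R.H (i + 1) x (R.H i (oplus x y) (R.H (i + 1) y m))"
  using U_braid[OF assms]
  by (intro ext) (simp add: R.H_def R.K_eq R.U_add R.U_scale R.U_U, simp add: oplus_def algebra_simps)

text \<open>The factor \<open>(1 + \<beta> x) + (y - x) u\<^sub>i\<close> is \<open>1 + \<beta> x\<close> times \<open>h\<^sub>i\<close> at the formal difference of \<open>y\<close> and \<open>x\<close>,
  which is not a polynomial itself.\<close>

lemma yang_baxter_K:
  assumes "0 < i"
  shows "R.K i (1 + beta * x) (y - x) (R.H (i + 1) y (R.H i x m)) =
    R.H (i + 1) x (R.H i y (R.K (i + 1) (1 + beta * x) (y - x) m))"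
  using U_braid[OF assms]
  by (intro ext) (simp add: R.H_def R.K_eq R.U_add R.U_scale R.U_U, simp add: algebra_simps)

text \<open>By \<open>yang_baxter_K\<close> the factor \<open>K\<close> climbs from index
  \<open>a\<close> to \<open>n - 1\<close>, exchanging the parameters of the two rows on its way; at
  the top \<open>K_H\<close> absorbs it.\<close>

lemma row_row_K:
  assumes "0 < a" "a < n"
  shows "R.K a (1 + beta * x) (y - x) (R.act (row n a x @ row n (a + 1) y) m) =
    (\<lambda>z. (1 + beta * x) * R.act (row n a y @ row n (a + 1) x) m z)"
  using assms(2,1)
proof (induction a arbitrary: m rule: int_less_induct)
  case base
  then show ?case by (simp add: row_rec R.K_H)
next
  case (step a)
  have c: "R.act (row n (a + 1) x') (R.H (a - 1) x m) = R.H (a - 1) x (R.act (row n (a + 1) x') m)"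
    for x x' m by (intro act_H) (auto dest: set_row)
  have "R.act (row n (a - 1) x @ row n a y) m =
    R.H a y (R.H (a - 1) x (R.act (row n a x @ row n (a + 1) y) m))" for x y
    using step by (simp add: row_rec[of "a - 1"] row_rec[of a] c)
  then show ?case
    using step yang_baxter_K[of "a - 1"] by (simp add: R.H_scale)
qed

section \<open>The Fomin--Kirillov product\<close>

lemma rows_step: "rows n a y = row n a (y a) @ rows n (a + 1) y"
  by (cases "a < n") (simp_all add: rows_rec)

text \<open>Adapted to lists such as \<open>rows n a y\<close>, which are empty for
  \<open>n \<le> a\<close> and otherwise extend the list at \<open>a + 1\<close>.\<close>

lemma downward_induct [case_names base step]:
  fixes a n :: int
  assumes "\<And>a. n \<le> a \<Longrightarrow> P a" "\<And>a. a < n \<Longrightarrow> P (a + 1) \<Longrightarrow> P a"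
  shows "P a"
proof (induction "nat (n - a)" arbitrary: a rule: less_induct)
  case less
  then show ?case using assms by (cases "a < n") auto
qed

lemma rows_cong: "(\<And>k. a \<le> k \<Longrightarrow> y k = y' k) \<Longrightarrow> rows n a y = rows n a y'"
  by (induction a rule: downward_induct[of n]) (auto simp: rows_rec)

text \<open>Rows beyond \<open>i + 1\<close> use indices at least \<open>i + 2\<close> and commute
  with the factor \<open>K\<close>; rows before \<open>i\<close> act first and are absorbed into
  \<open>m\<close>. What remains is \<open>row_row_K\<close> for two adjacent rows.\<close>

lemma rows_K:
  assumes "0 < a" "a \<le> i" "i < n"
  shows "R.K i (1 + beta * y i) (y (i + 1) - y i) (R.act (rows n a y) m) =
    (\<lambda>z. (1 + beta * y i) * R.act (rows n a (y \<circ> adj i)) m z)"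
  using assms(2,1)
proof (induction a arbitrary: m rule: int_le_induct)
  case base
  have e: "rows n (i + 2) (y \<circ> adj i) = rows n (i + 2) y"
    by (rule rows_cong) (simp add: adj_apply)
  have s: "rows n i y = row n i (y i) @ row n (i + 1) (y (i + 1)) @ rows n (i + 2) y" for y
    by (simp only: rows_step[of n i] rows_step[of n "i + 1"] add.assoc one_add_one)
  have c: "R.K i a b (R.act (rows n (i + 2) y) m) = R.act (rows n (i + 2) y) (R.K i a b m)" for a b m
    by (intro act_K[symmetric]) (auto dest: set_rows)
  show ?case
    using row_row_K[OF base assms(3), of "y i" "y (i + 1)" m]
    by (simp add: s e[unfolded o_def] c R.act_scale o_def)
next
  case (step a)
  have "(y \<circ> adj i) (a - 1) = y (a - 1)" using step by (simp add: adj_apply)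
  then show ?case using step by (simp add: rows_step[of n "a - 1"])
qed

lemma swap_vars_act:
  "swap_vars i (R.act L m w) =
    R.act (map (\<lambda>(j, x). (j, swap_vars i x)) L) (\<lambda>w. swap_vars i (m w)) w"
proof (induction L arbitrary: m)
  case (Cons p L)
  obtain j x where p: "p = (j, x)" by (cases p)
  have "(\<lambda>w. swap_vars i (R.H j x m w)) = R.H j (swap_vars i x) (\<lambda>w. swap_vars i (m w))"
    by (auto simp: fun_eq_iff R.H_def R.K_def R.U_def swap_vars_add swap_vars_mult swap_vars_0)
  then show ?case using Cons by (simp add: p)
qed simp

lemma map_rows: "map (\<lambda>(j, x). (j, f x)) (rows n a y) = rows n a (\<lambda>k. f (y k))"
  by (simp add: rows_def row_def map_concat o_def)

definition fk :: "int \<Rightarrow> (int \<Rightarrow> int) \<Rightarrow> pol" where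
  "fk n = R.act (rows n 1 X) R.unit"

text \<open>Exchanging two variables permutes the row parameters, so \<open>rows_K\<close> applies.
  This is the divided difference recursion with denominators cleared, for ascents and descents at
  once.\<close>

lemma fk_rel:
  assumes "0 < i" "i < n"
  shows "(1 + beta * X i) * swap_vars i (fk n w) =
    (1 + beta * X i) * fk n w + (X (i + 1) - X i) * R.U i (fk n) w"
proof -
  have u: "(\<lambda>w. swap_vars i (R.unit w)) = R.unit"
    by (auto simp: R.unit_def fun_eq_iff swap_vars_0)
  have "swap_vars i (fk n w) = R.act (rows n 1 (X \<circ> adj i)) R.unit w"
    by (simp add: fk_def swap_vars_act u map_rows o_def)
  with fun_cong[OF rows_K[of 1 i n X R.unit], of w] assms show ?thesis
    by (simp add: fk_def R.K_def)
qed

text \<open>A permutation in \<open>S_fin n\<close> has no descent at \<open>j \<ge> n\<close>, so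
  factors with such an index do not change its coefficient; for smaller \<open>j\<close> the partner
  stays in \<open>S_fin n\<close>.\<close>

lemma act_agree:
  assumes "\<And>w. w \<in> S_fin n \<Longrightarrow> m w = m' w" "w \<in> S_fin n"
  shows "R.act L m w = R.act (filter (\<lambda>(j, x). j < n) L) m' w"
  using assms
proof (induction L arbitrary: m m')
  case (Cons p L)
  obtain j x where p: "p = (j, x)" by (cases p)
  have "R.H j x m w = (if j < n then R.H j x m' w else m' w)" if w: "w \<in> S_fin n" for w
  proof (cases "j < n")
    case True
    then have "0 < j \<Longrightarrow> rmul j w \<in> S_fin n" using w by (simp add: rmul_def S_fin_comp_adj_iff)
    then show ?thesis
      using True Cons.prems(1) w by (simp add: R.H_def R.K_def R.U_def)
  next
    case False
    then have "\<not> rdesc j w"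
      using S_fin_fix[OF w, of "j + 1"] S_fin_fix[OF w, of j] S_fin_range[OF w, of j]
      \<comment> \<open>In the borderline case \<open>j = n\<close> the value at \<open>n\<close> is
        at most \<open>n\<close>, while \<open>n + 1\<close> is fixed.\<close>
      by (cases "j = n \<and> 1 \<le> j") (auto simp: rdesc_def)
    then show ?thesis using False Cons.prems(1) w by (simp add: R.H_def R.K_def R.U_def)
  qed
  then have "R.act L (R.H j x m) w =
      R.act (filter (\<lambda>(j, x). j < n) L) (if j < n then R.H j x m' else m') w"
    using Cons.prems(2) by (intro Cons.IH) auto
  then show ?case by (simp add: p)
qed auto

lemma filter_row: "n \<le> n' \<Longrightarrow> filter (\<lambda>(j, x). j < n) (row n' a x) = row n a x"
  by (induction a rule: downward_induct[of n']) (auto simp: row_rec)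

lemma filter_rows: "n \<le> n' \<Longrightarrow> filter (\<lambda>(j, x). j < n) (rows n' a y) = rows n a y"
proof (induction a rule: downward_induct[of n'])
  case (step a)
  then show ?case
    by (cases "a < n") (simp_all add: rows_step[of n' a] rows_step[of n a] filter_row)
qed simp

lemma fk_stable: "w \<in> S_fin n \<Longrightarrow> n \<le> n' \<Longrightarrow> fk n' w = fk n w"
  unfolding fk_def using act_agree[of n R.unit R.unit w "rows n' 1 X"] by (simp add: filter_rows)

section \<open>The coefficient of the longest permutation\<close>

lemma length_row: "length (row n a x) = nat (n - a)"
  by (simp add: row_def)

lemma length_rows: "length (rows n a y) = card {(i, j). a \<le> i \<and> i < j \<and> j \<le> n}"
proof (induction a rule: downward_induct[of n])
  case (base a)
  then have e: "{(i, j). a \<le> i \<and> i < j \<and> j \<le> n} = {}" by auto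
  show ?case unfolding e using base by simp
next
  case (step a)
  let ?A = "\<lambda>a. {(i, j). a \<le> i \<and> i < j \<and> j \<le> n}"
  have fin: "finite (?A (a + 1))"
    by (rule finite_subset[of _ "{a..n} \<times> {a..n}"]) auto
  have "?A a = Pair a ` {a<..n} \<union> ?A (a + 1)" by auto
  moreover have "card (Pair a ` {a<..n}) = nat (n - a)"
    by (simp add: card_image inj_on_def)
  moreover have "Pair a ` {a<..n} \<inter> ?A (a + 1) = {}" by auto
  ultimately have "card (?A a) = nat (n - a) + card (?A (a + 1))"
    using fin by (simp add: card_Un_disjoint)
  then show ?case using step by (simp add: rows_step[of n a] length_row)
qed

lemma len_longest: "len (longest n) = length (rows n 1 y)"
proof -
  have "{(i, j). i < j \<and> longest n j < longest n i} = {(i, j). 1 \<le> i \<and> i < j \<and> j \<le> n}"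
    by (auto simp: longest_def split: if_splits)
  then show ?thesis by (simp add: len_def length_rows)
qed

lemma fold_rmul_row:
  "a \<le> n \<Longrightarrow> fold rmul (map fst (row n a x)) w =
    (\<lambda>k. w (if k = a then n else if a < k \<and> k \<le> n then k - 1 else k))"
proof (induction a rule: downward_induct[of n])
  case (step a)
  then have "fold rmul (map fst (row n a x)) w =
    rmul a (\<lambda>k. w (if k = a + 1 then n else if a + 1 < k \<and> k \<le> n then k - 1 else k))"
    by (simp add: row_rec[OF step(1)])
  also have "\<dots> = (\<lambda>k. w (if k = a then n else if a < k \<and> k \<le> n then k - 1 else k))"
  proof
    fix k
    consider "k = a" | "k = a + 1" | "k \<noteq> a" "k \<noteq> a + 1" by blast
    then show "rmul a (\<lambda>k. w (if k = a + 1 then n else if a + 1 < k \<and> k \<le> n then k - 1 else k)) k =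
      w (if k = a then n else if a < k \<and> k \<le> n then k - 1 else k)"
      using step(1) by cases (auto simp: rmul_def adj_apply)
  qed
  finally show ?case .
qed (auto simp: fun_eq_iff intro!: arg_cong[of _ _ w])

text \<open>Each row brings the last value to the front of the remaining interval, so together the
  rows reverse it.\<close>

lemma fold_rmul_rows:
  "a \<le> n \<Longrightarrow> fold rmul (map fst (rows n a y)) w =
    (\<lambda>k. w (if a \<le> k \<and> k \<le> n then n + a - k else k))"
proof (induction a arbitrary: w rule: downward_induct[of n])
  case (step a)
  have "fold rmul (map fst (rows n a y)) w =
    fold rmul (map fst (rows n (a + 1) y)) (fold rmul (map fst (row n a (y a))) w)"
    by (simp add: rows_step[of n a])
  also have "\<dots> = (\<lambda>k. w (if a \<le> k \<and> k \<le> n then n + a - k else k))"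
    using step by (auto simp: fold_rmul_row fun_eq_iff intro!: arg_cong[of _ _ w])
  finally show ?case .
qed (auto simp: fun_eq_iff intro!: arg_cong[of _ _ w])

lemma prod_list_row: "prod_list (map snd (row n a x)) = x ^ nat (n - a)"
  by (simp add: row_def o_def map_replicate_const)

lemma prod_list_rows: "prod_list (map snd (rows n a y)) = (\<Prod>k = a..n - 1. y k ^ nat (n - k))"
proof (induction a rule: downward_induct[of n])
  case (step a)
  then have "{a..n - 1} = insert a {a + 1..n - 1}" by auto
  then show ?case using step by (simp add: rows_step[of n a] prod_list_row)
qed simp

lemma fk_longest:
  assumes "1 \<le> n"
  shows "fk n (longest n) = (\<Prod>i = 1..n - 1. X i ^ nat (n - i))"
proof -
  have w: "R.walk (map fst (rows n 1 X)) = longest n"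
    using assms by (auto simp: R.walk_def fold_rmul_rows longest_def fun_eq_iff)
  have "\<forall>(i, x)\<in>set (rows n 1 X). 0 < i" by (auto dest: set_rows)
  from R.act_unit_walk[OF this] show ?thesis
    by (simp add: w len_longest[of n X] fk_def prod_list_rows)
qed

text \<open>By \<open>fk_stable\<close> the choice of \<open>n\<close> is immaterial; the recursion
  at \<open>i\<close> is \<open>fk_rel\<close> for some \<open>n\<close> larger than
  \<open>i\<close>.\<close>

lemma grothendieck_family_fk:
  "grothendieck_family (\<lambda>w. fk (SOME n. w \<in> S_fin n) w)" (is "grothendieck_family ?G")
proof -
  have G: "?G w = fk n w" if "w \<in> S_fin n" for w n
  proof -
    have "w \<in> S_fin (SOME n. w \<in> S_fin n)" using that by (rule someI)
    then show ?thesis using that fk_stable by (metis linorder_le_cases)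
  qed
  have "divdiff_beta i (?G w) = (if w i > w (i + 1) then ?G (w \<circ> adj i) else - beta * ?G w)"
    if w: "w \<in> S_inf" and i: "0 < i" for w i
  proof -
    obtain n where n: "i < n" "w \<in> S_fin n"
    proof -
      obtain n where "w \<in> S_fin n" using S_inf_in_S_fin w by blast
      then have "w \<in> S_fin (max n (i + 1))" using S_fin_mono[of n "max n (i + 1)"] by auto
      then show thesis using that[of "max n (i + 1)"] by auto
    qed
    have "w \<circ> adj i \<in> S_fin n" using n i by (simp add: S_fin_comp_adj_iff)
    then have G': "?G w = fk n w" "?G (w \<circ> adj i) = fk n (w \<circ> adj i)" using G n by blast+
    show ?thesis
      using fk_rel[OF i n(1), of w] i w
      unfolding G' by (intro divdiff_beta_eqI) (auto simp: R.U_def rdesc_def rmul_def algebra_simps)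
  qed
  moreover have "?G (longest n) = (\<Prod>i = 1..n - 1. X i ^ nat (n - i))" if "1 \<le> n" for n
    using fk_longest[OF that] G[OF longest_S_fin] by simp
  ultimately show ?thesis unfolding grothendieck_family_def by blast
qed

section \<open>Uniqueness of Grothendieck polynomials\<close>

lemma len_le: assumes "w \<in> S_fin n" shows "len w \<le> card ({1..n} \<times> {1..n})"
  unfolding len_def
proof (rule card_mono)
  show "{(i, j). i < j \<and> w i > w j} \<subseteq> {1..n} \<times> {1..n}"
    using S_fin_range[OF assms] S_fin_fix[OF assms]
    by (clarsimp simp: subset_iff) (smt (verit, best))
qed simp

lemma grothendieck_family_unique:
  assumes "grothendieck_family G" "grothendieck_family G'" "1 \<le> n" "w \<in> S_fin n"
  shows "G w = G' w"
  using assms(4)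
proof (induction "card ({1..n} \<times> {1..n}) - len w" arbitrary: w rule: less_induct)
  case less
  show ?case
  proof (cases "w = longest n")
    case True
    then show ?thesis using assms(1-3) by (simp add: grothendieck_family_def)
  next
    case False
    then obtain i where i: "0 < i" "i < n" "w i < w (i + 1)"
      using S_fin_exists_asc less.prems by metis
    let ?v = "w \<circ> adj i"
    have S: "w \<in> S_inf" using less.prems S_fin_subset_S_inf by blast
    have v: "?v \<in> S_fin n" using less.prems i by (simp add: S_fin_comp_adj_iff)
    then have vS: "?v \<in> S_inf" using S_fin_subset_S_inf by blast
    have "len ?v = Suc (len w)" using len_comp_adj S i by blast
    then have eq: "G ?v = G' ?v" using less.hyps[OF _ v] len_le[OF v] by simp
    have "?v i > ?v (i + 1)" using i by (simp add: adj_apply)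
    \<comment> \<open>The longer permutation \<open>?v\<close> has a descent at \<open>i\<close>, so
      the recursion there computes the value at \<open>w\<close>.\<close>
    then have "F w = divdiff_beta i (F ?v)" if "grothendieck_family F" for F
      using that vS i unfolding grothendieck_family_def by (metis comp_adj_adj)
    then show ?thesis using assms eq by metis
  qed
qed

lemma grothendieck_family_grothendieck: "grothendieck_family grothendieck"
  unfolding grothendieck_def by (rule someI[where P = grothendieck_family], rule grothendieck_family_fk)

lemma grothendieck_eq_fk:
  assumes "w \<in> S_fin n" "1 \<le> n"
  shows "grothendieck w = fk n w"
proof -
  have "w \<in> S_fin (SOME n. w \<in> S_fin n)" using assms(1) by (rule someI)
  then have "fk (SOME n. w \<in> S_fin n) w = fk n w" using assms fk_stable by (metis linorder_le_cases)
  then show ?thesis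
    using grothendieck_family_unique[OF grothendieck_family_grothendieck grothendieck_family_fk assms(2,1)]
    by simp
qed

lemma grothendieck_rel:
  assumes "0 < i" "w \<in> S_inf"
  shows "(1 + beta * X i) * swap_vars i (grothendieck w) =
    (1 + beta * X i) * grothendieck w + (X (i + 1) - X i) * R.U i grothendieck w"
proof -
  obtain n where n: "i < n" "1 \<le> n" "w \<in> S_fin n"
  proof -
    obtain n where "w \<in> S_fin n" using S_inf_in_S_fin assms by blast
    then have "w \<in> S_fin (max n (i + 1))" using S_fin_mono[of n "max n (i + 1)"] by auto
    then show thesis using that[of "max n (i + 1)"] assms by auto
  qed
  have "rmul i w \<in> S_fin n" using n assms by (simp add: S_fin_comp_adj_iff rmul_def)
  then have "R.U i grothendieck w = R.U i (fk n) w"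
    using grothendieck_eq_fk n by (simp add: R.U_def)
  then show ?thesis using fk_rel[OF assms(1) n(1)] grothendieck_eq_fk n by simp
qed

section \<open>The Demazure product\<close>

text \<open>Demazure multiplication by \<open>s_i\<close> on the left, with the length condition
  expressed through positions.\<close>

definition lstep :: "int \<Rightarrow> (int \<Rightarrow> int) \<Rightarrow> int \<Rightarrow> int" where
  "lstep i w = (if inv w i < inv w (i + 1) then adj i \<circ> w else w)"

definition rstep :: "int \<Rightarrow> (int \<Rightarrow> int) \<Rightarrow> int \<Rightarrow> int" where
  "rstep i w = (if w i < w (i + 1) then w \<circ> adj i else w)"

lemma lstep_S_inf: "0 < i \<Longrightarrow> w \<in> S_inf \<Longrightarrow> lstep i w \<in> S_inf"
  by (simp add: lstep_def)

lemma adj_less_iff: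
  "\<not> (a = j \<and> b = j + 1) \<Longrightarrow> \<not> (a = j + 1 \<and> b = j) \<Longrightarrow> adj j a < adj j b \<longleftrightarrow> a < b"
  by (auto simp: adj_apply)

lemma inv_S_inf_eq_iff: "w \<in> S_inf \<Longrightarrow> inv w a = b \<longleftrightarrow> w b = a"
  using S_inf_bij bij_inv_eq_iff by metis

lemma adj_comp_eq_comp_adj:
  assumes "w \<in> S_inf" "w j = i \<and> w (j + 1) = i + 1 \<or> w j = i + 1 \<and> w (j + 1) = i"
  shows "adj i \<circ> w = w \<circ> adj j"
proof
  fix x
  consider "x = j" | "x = j + 1" | "x \<noteq> j" "x \<noteq> j + 1" by blast
  then show "(adj i \<circ> w) x = (w \<circ> adj j) x"
  proof cases
    case 3
    then have "w x \<noteq> w j" "w x \<noteq> w (j + 1)" using S_inf_inj[OF assms(1)] by auto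
    then show ?thesis using 3 assms(2) by (auto simp: adj_apply)
  qed (use assms(2) in \<open>auto simp: adj_apply\<close>)
qed

text \<open>The two steps interfere only if \<open>w\<close> carries \<open>{j, j + 1}\<close> onto
  \<open>{i, i + 1}\<close>. Then \<open>s_i w = w s_j\<close>, and either order of the steps
  multiplies once at an ascent and does nothing at a descent.\<close>

lemma lstep_rstep:
  assumes "w \<in> S_inf" "0 < i" "0 < j"
  shows "lstep i (rstep j w) = rstep j (lstep i w)"
proof -
  have inv1: "inv (w \<circ> adj j) = adj j \<circ> inv w" by (rule inv_comp_adj) fact
  note e = inv_S_inf_eq_iff[OF assms(1)]
  consider (asc) "w j = i" "w (j + 1) = i + 1" | (dsc) "w j = i + 1" "w (j + 1) = i"
    | (other) "\<not> (w j = i \<and> w (j + 1) = i + 1)" "\<not> (w j = i + 1 \<and> w (j + 1) = i)" by blast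
  then show ?thesis
  proof cases
    case asc
    then have i: "inv w i = j" "inv w (i + 1) = j + 1" by (simp_all add: e)
    have "adj i \<circ> w = w \<circ> adj j" using asc assms by (intro adj_comp_eq_comp_adj) auto
    then show ?thesis using asc i by (simp add: lstep_def rstep_def inv1)
  next
    case dsc
    then have i: "inv w i = j + 1" "inv w (i + 1) = j" by (simp_all add: e)
    then show ?thesis using dsc by (simp add: lstep_def rstep_def)
  next
    case other
    have "adj j (inv w i) < adj j (inv w (i + 1)) \<longleftrightarrow> inv w i < inv w (i + 1)"
      using other by (intro adj_less_iff) (auto simp: e)
    moreover have "adj i (w j) < adj i (w (j + 1)) \<longleftrightarrow> w j < w (j + 1)"
      using other by (intro adj_less_iff) auto
    ultimately show ?thesis by (simp add: lstep_def rstep_def inv1 comp_assoc)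
  qed
qed

definition lsteps :: "int list \<Rightarrow> (int \<Rightarrow> int) \<Rightarrow> int \<Rightarrow> int" where
  "lsteps = foldr lstep"

lemma lsteps_simps [simp]: "lsteps [] w = w" "lsteps (i # a) w = lstep i (lsteps a w)"
  by (simp_all add: lsteps_def)

lemma lsteps_append: "lsteps (a @ b) w = lsteps a (lsteps b w)"
  by (simp add: lsteps_def)

lemma lsteps_S_inf: "\<forall>i\<in>set a. 0 < i \<Longrightarrow> w \<in> S_inf \<Longrightarrow> lsteps a w \<in> S_inf"
  by (induction a) (auto simp: lstep_S_inf)

lemma lsteps_rstep:
  "\<forall>i\<in>set a. 0 < i \<Longrightarrow> w \<in> S_inf \<Longrightarrow> 0 < j \<Longrightarrow> lsteps a (rstep j w) = rstep j (lsteps a w)"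
  by (induction a) (auto simp: lstep_rstep lsteps_S_inf)

text \<open>Induction along a reduced word: removing a descent lowers the length.\<close>

lemma S_inf_induct [consumes 1, case_names id step]:
  assumes "w \<in> S_inf" "P id"
    and "\<And>v j. v \<in> S_inf \<Longrightarrow> P v \<Longrightarrow> 0 < j \<Longrightarrow> v j < v (j + 1) \<Longrightarrow> P (v \<circ> adj j)"
  shows "P w"
  using assms(1)
proof (induction "len w" arbitrary: w rule: less_induct)
  case less
  show ?case
  proof (cases "w = id")
    case False
    then obtain j where j: "0 < j" "w j > w (j + 1)"
      using S_inf_exists_desc less.prems by metis
    have v: "w \<circ> adj j \<in> S_inf" using j less.prems by simp
    have "len w = Suc (len (w \<circ> adj j))" using j less.prems by (intro len_comp_adj_desc)
    then have "P (w \<circ> adj j)" using less.hyps v by simp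
    then have "P (w \<circ> adj j \<circ> adj j)" using j v by (rule_tac assms(3)) (auto simp: adj_apply)
    then show ?thesis by simp
  qed (use assms(2) in simp)
qed

lemma lsteps_surj:
  assumes "w \<in> S_inf" obtains a where "\<forall>i\<in>set a. 0 < i" "lsteps a id = w"
proof -
  \<comment> \<open>Inverting turns the right steps of \<open>S_inf_induct\<close> into left
    steps.\<close>
  have "\<exists>a. (\<forall>i\<in>set a. 0 < i) \<and> lsteps a id = inv v" if "v \<in> S_inf" for v
    using that
  proof (induction v rule: S_inf_induct)
    case id
    show ?case by (rule exI[of _ "[]"]) simp
  next
    case (step v j)
    then obtain a where a: "\<forall>i\<in>set a. 0 < i" "lsteps a id = inv v" by blast
    have "lsteps (j # a) id = inv (v \<circ> adj j)"
      using step a by (simp add: lstep_def inv_comp_adj inv_inv_S_inf)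
    moreover have "\<forall>i\<in>set (j # a). 0 < i" using a step by simp
    ultimately show ?case by blast
  qed
  from this[of "inv w"] that show thesis using assms by (auto simp: inv_inv_S_inf S_inf_inv)
qed

text \<open>Left steps commute with right steps, and every element of \<^const>\<open>S_inf\<close> is reached from the identity
  by right steps; hence a composite of left steps is determined by its value at the identity. This
  makes the Demazure product well defined.\<close>

lemma lsteps_determined:
  assumes "w \<in> S_inf" "\<forall>i\<in>set a. 0 < i" "\<forall>i\<in>set b. 0 < i" "lsteps a id = lsteps b id"
  shows "lsteps a w = lsteps b w"
  using assms(1)
proof (induction w rule: S_inf_induct)
  case id
  show ?case by (rule assms(4))
next
  case (step v j)
  have "v \<circ> adj j = rstep j v" using step by (simp add: rstep_def)
  then show ?case using step assms by (simp add: lsteps_rstep)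
qed

text \<open>Let \<open>u\<close> act on \<open>v\<close> by the left steps of a word for
  \<open>u\<close>. Independence of the word is \<open>lsteps_determined\<close>, and associativity
  is concatenation of words.\<close>

lemma is_demazure_product_exists: "\<exists>d. is_demazure_product d"
proof -
  define word where "word u = (SOME a. (\<forall>i\<in>set a. 0 < i) \<and> lsteps a id = u)" for u
  have word: "\<forall>i\<in>set (word u). 0 < i" "lsteps (word u) id = u" if "u \<in> S_inf" for u
  proof -
    have "\<exists>a. (\<forall>i\<in>set a. 0 < i) \<and> lsteps a id = u" using lsteps_surj[OF that] by metis
    then have "(\<forall>i\<in>set (word u). 0 < i) \<and> lsteps (word u) id = u"
      unfolding word_def by (rule someI_ex)
    then show "\<forall>i\<in>set (word u). 0 < i" "lsteps (word u) id = u" by auto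
  qed
  define d where "d u v = lsteps (word u) v" for u v
  have d: "d (lsteps a id) v = lsteps a v" if "\<forall>i\<in>set a. 0 < i" "v \<in> S_inf" for a v
    unfolding d_def using that word[of "lsteps a id"] lsteps_S_inf[of a id]
    by (rule_tac lsteps_determined) auto
  have "d u v \<in> S_inf" if "u \<in> S_inf" "v \<in> S_inf" for u v
    unfolding d_def using word that by (intro lsteps_S_inf) auto
  moreover have "d (d u v) w = d u (d v w)" if "u \<in> S_inf" "v \<in> S_inf" "w \<in> S_inf" for u v w
  proof -
    have "d u v = lsteps (word u @ word v) id"
      using word that by (simp add: d_def lsteps_append)
    then have "d (d u v) w = lsteps (word u @ word v) w"
      using word that by (simp only:) (rule d, auto)
    then show ?thesis by (simp add: d_def lsteps_append)
  qed
  moreover have "d (adj i) w = (if len (adj i \<circ> w) > len w then adj i \<circ> w else w)"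
    if "0 < i" "w \<in> S_inf" for i w
  proof -
    have "adj i = lsteps [i] id" by (simp add: lstep_def)
    then have "d (adj i) w = lstep i w" using d[of "[i]" w] that by simp
    then show ?thesis using that by (simp add: len_adj_comp_less_iff lstep_def)
  qed
  ultimately show ?thesis unfolding is_demazure_product_def by blast
qed

lemma
  shows demazure_S_inf: "u \<in> S_inf \<Longrightarrow> v \<in> S_inf \<Longrightarrow> demazure u v \<in> S_inf"
    and demazure_assoc: "u \<in> S_inf \<Longrightarrow> v \<in> S_inf \<Longrightarrow> w \<in> S_inf \<Longrightarrow>
      demazure (demazure u v) w = demazure u (demazure v w)"
    and demazure_adj: "0 < i \<Longrightarrow> w \<in> S_inf \<Longrightarrow> demazure (adj i) w = lstep i w"
proof -
  have *: "is_demazure_product demazure"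
    unfolding demazure_def using is_demazure_product_exists by (rule someI_ex)
  show "u \<in> S_inf \<Longrightarrow> v \<in> S_inf \<Longrightarrow> demazure u v \<in> S_inf"
    "u \<in> S_inf \<Longrightarrow> v \<in> S_inf \<Longrightarrow> w \<in> S_inf \<Longrightarrow>
      demazure (demazure u v) w = demazure u (demazure v w)"
    using * unfolding is_demazure_product_def by blast+
  show "0 < i \<Longrightarrow> w \<in> S_inf \<Longrightarrow> demazure (adj i) w = lstep i w"
    using * unfolding is_demazure_product_def by (simp add: len_adj_comp_less_iff lstep_def)
qed

text \<open>Associativity gives \<open>s\<^sub>i \<circ> (1 \<circ> w) = s\<^sub>i \<circ> w\<close>, and for large \<open>i\<close> both sides are ordinary
  products, from which \<open>s\<^sub>i\<close> cancels.\<close>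

lemma demazure_id: assumes "w \<in> S_inf" shows "demazure id w = w"
proof -
  let ?v = "demazure id w"
  have v: "?v \<in> S_inf" using assms by (simp add: demazure_S_inf)
  obtain n m where nm: "1 \<le> n" "w \<in> S_fin n" "1 \<le> m" "?v \<in> S_fin m"
    using S_inf_in_S_fin v assms by metis
  define i where "i = max n m + 1"
  have "n < i" "m < i" by (auto simp: i_def)
  then have i: "0 < i" "w i = i" "w (i + 1) = i + 1" "?v i = i" "?v (i + 1) = i + 1"
    using nm by (auto intro!: S_fin_fix[OF nm(2)] S_fin_fix[OF nm(4)])
  then have "inv w i = i" "inv w (i + 1) = i + 1" "inv ?v i = i" "inv ?v (i + 1) = i + 1"
    using assms v by (simp_all add: inv_S_inf_eq_iff)
  then have "lstep i w = adj i \<circ> w" "lstep i ?v = adj i \<circ> ?v" by (simp_all add: lstep_def)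
  moreover have "lstep i ?v = lstep i w"
  proof -
    have "demazure (demazure (adj i) id) w = demazure (adj i) ?v"
      using assms i by (intro demazure_assoc) auto
    moreover have "demazure (adj i) id = adj i"
      using i by (simp add: demazure_adj lstep_def)
    ultimately show ?thesis using i assms v by (simp add: demazure_adj)
  qed
  ultimately have "adj i \<circ> (adj i \<circ> ?v) = adj i \<circ> (adj i \<circ> w)" by simp
  then show ?thesis by simp
qed

lemma demazure_lsteps:
  assumes "\<forall>i\<in>set a. 0 < i" "v \<in> S_inf"
  shows "demazure (lsteps a id) v = lsteps a v"
  using assms
proof (induction a)
  case (Cons i a)
  have u: "lsteps a id \<in> S_inf" using Cons.prems by (intro lsteps_S_inf) auto
  have "demazure (lsteps (i # a) id) v = demazure (demazure (adj i) (lsteps a id)) v"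
    using Cons.prems u by (simp add: demazure_adj)
  also have "\<dots> = demazure (adj i) (demazure (lsteps a id) v)"
    using Cons.prems u by (intro demazure_assoc) auto
  also have "\<dots> = lsteps (i # a) v"
    using Cons lsteps_S_inf[of a v] by (simp add: demazure_adj del: id_apply)
  finally show ?case .
qed (simp add: demazure_id del: id_apply)

section \<open>The map from \<open>w\<close> to the Demazure product of its inverse with
  \<open>w\<close>\<close>

definition dem_sq :: "(int \<Rightarrow> int) \<Rightarrow> int \<Rightarrow> int" where
  "dem_sq w = demazure (inv w) w"

lemma dem_sq_id: "dem_sq id = id"
  by (simp add: dem_sq_def demazure_id)

text \<open>A word for the inverse of \<open>w \<circ> adj j\<close> is \<open>j\<close> followed by
  one for the inverse of \<open>w\<close>; the right step by \<open>j\<close> commutes past the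
  latter.\<close>

lemma dem_sq_step:
  assumes "w \<in> S_inf" "0 < j" "w j < w (j + 1)"
  shows "dem_sq (w \<circ> adj j) = lstep j (rstep j (dem_sq w))"
proof -
  obtain a where a: "\<forall>i\<in>set a. 0 < i" "lsteps a id = inv w"
    using lsteps_surj S_inf_inv assms by metis
  have "inv (w \<circ> adj j) = lsteps (j # a) id"
    using assms a by (simp add: inv_comp_adj lstep_def inv_inv_S_inf)
  then have "dem_sq (w \<circ> adj j) = lsteps (j # a) (w \<circ> adj j)"
    unfolding dem_sq_def using assms a by (simp only:) (rule demazure_lsteps, auto)
  also have "\<dots> = lsteps (j # a) (rstep j w)" using assms by (simp add: rstep_def)
  also have "\<dots> = lstep j (rstep j (lsteps a w))"
    using assms a by (simp add: lsteps_rstep)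
  also have "lsteps a w = dem_sq w"
    unfolding dem_sq_def using assms a demazure_lsteps by metis
  finally show ?thesis .
qed

section \<open>Involutions\<close>

definition Invol :: "(int \<Rightarrow> int) set" where
  "Invol = {z \<in> S_inf. z \<circ> z = id}"

text \<open>Conjugation by \<open>s_i\<close>, replaced by multiplication where conjugation would
  fix \<open>z\<close>; at ascents these are the steps of the weak order on involutions.\<close>

definition twist :: "int \<Rightarrow> (int \<Rightarrow> int) \<Rightarrow> int \<Rightarrow> int" where
  "twist i z = (if adj i \<circ> z = z \<circ> adj i then z \<circ> adj i else adj i \<circ> z \<circ> adj i)"

lemma Invol_S_inf: "z \<in> Invol \<Longrightarrow> z \<in> S_inf"
  by (simp add: Invol_def)

lemma Invol_Invol: "z \<in> Invol \<Longrightarrow> z (z x) = x"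
  by (simp add: Invol_def fun_eq_iff)

lemma Invol_inv: "z \<in> Invol \<Longrightarrow> inv z = z"
  by (simp add: Invol_def inv_unique_comp)

lemma commute_iff:
  assumes "z \<in> Invol"
  shows "adj i \<circ> z = z \<circ> adj i \<longleftrightarrow>
    z i = i \<and> z (i + 1) = i + 1 \<or> z i = i + 1 \<and> z (i + 1) = i" (is "?L \<longleftrightarrow> ?R")
proof
  assume L: ?L
  have ne: "z i \<noteq> z (i + 1)" using assms S_inf_inj Invol_S_inf by simp
  show ?R using fun_cong[OF L, of i] fun_cong[OF L, of "i + 1"] ne
    by (auto simp: adj_apply split: if_splits)
qed (use adj_comp_eq_comp_adj Invol_S_inf assms in blast)

lemma twist_S_inf: "0 < i \<Longrightarrow> z \<in> S_inf \<Longrightarrow> twist i z \<in> S_inf"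
  by (simp add: twist_def)

lemma twist_Invol: assumes "0 < i" "z \<in> Invol" shows "twist i z \<in> Invol"
proof -
  have zz: "z \<circ> z = id" and S: "z \<in> S_inf" using assms by (auto simp: Invol_def)
  have "twist i z \<circ> twist i z = id"
  proof (cases "adj i \<circ> z = z \<circ> adj i")
    case True
    have "z \<circ> adj i \<circ> (z \<circ> adj i) = z \<circ> (adj i \<circ> z) \<circ> adj i" by (simp add: comp_assoc)
    also have "\<dots> = id" by (simp add: True zz comp_assoc[symmetric])
    finally show ?thesis using True by (simp add: twist_def)
  next
    case False
    have "adj i \<circ> z \<circ> adj i \<circ> (adj i \<circ> z \<circ> adj i) = adj i \<circ> (z \<circ> z) \<circ> adj i"
      by (simp add: comp_assoc)
    then show ?thesis using False zz by (simp add: twist_def)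
  qed
  then show ?thesis using assms(1) S by (simp add: Invol_def twist_S_inf)
qed

lemma twist_twist: "twist i (twist i z) = z"
proof (cases "adj i \<circ> z = z \<circ> adj i")
  case True
  then have "adj i \<circ> (z \<circ> adj i) = z \<circ> adj i \<circ> adj i" by (metis comp_assoc)
  then show ?thesis using True by (simp add: twist_def)
next
  case False
  have "adj i \<circ> (adj i \<circ> z \<circ> adj i) \<noteq> adj i \<circ> z \<circ> adj i \<circ> adj i"
    using False by (metis adj_comp_adj comp_adj_adj comp_assoc)
  then show ?thesis using False by (simp add: twist_def comp_assoc)
qed

lemma rdesc_twist:
  assumes "z \<in> Invol" shows "rdesc i (twist i z) \<longleftrightarrow> \<not> rdesc i z"
proof -
  have ne: "z i \<noteq> z (i + 1)" using assms S_inf_inj Invol_S_inf by simp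
  show ?thesis
  proof (cases "adj i \<circ> z = z \<circ> adj i")
    case True
    then show ?thesis using ne by (auto simp: twist_def rdesc_def)
  next
    case False
    then have "adj i (z i) < adj i (z (i + 1)) \<longleftrightarrow> z i < z (i + 1)"
      using commute_iff[OF assms] by (intro adj_less_iff) auto
    then show ?thesis using False ne by (auto simp: twist_def rdesc_def)
  qed
qed

lemma lstep_rstep_Invol:
  assumes "z \<in> Invol"
  shows "lstep i (rstep i z) = (if rdesc i z then z else twist i z)"
proof (cases "rdesc i z")
  case True
  then show ?thesis using assms by (simp add: rdesc_def lstep_def rstep_def Invol_inv)
next
  case False
  have "z i \<noteq> z (i + 1)" using assms S_inf_inj Invol_S_inf by simp
  then have asc: "z i < z (i + 1)" using False by (simp add: rdesc_def)
  have i: "inv (z \<circ> adj i) = adj i \<circ> z" using assms by (simp add: inv_comp_adj Invol_S_inf Invol_inv)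
  \<comment> \<open>After the right step, the left step is blocked exactly when \<open>s_i\<close>
    commutes with \<open>z\<close>.\<close>
  have "adj i (z i) < adj i (z (i + 1)) \<longleftrightarrow> adj i \<circ> z \<noteq> z \<circ> adj i"
    using asc by (auto simp: commute_iff[OF assms] adj_apply)
  then show ?thesis using asc False by (simp add: lstep_def rstep_def twist_def i comp_assoc)
qed

lemma dem_sq_Invol: "w \<in> S_inf \<Longrightarrow> dem_sq w \<in> Invol"
proof (induction w rule: S_inf_induct)
  case id
  show ?case by (simp add: dem_sq_id Invol_def del: id_apply)
qed (simp add: dem_sq_step lstep_rstep_Invol twist_Invol del: o_apply)

lemma dem_sq_comp_adj:
  assumes "w \<in> S_inf" "0 < j" "w j < w (j + 1)"
  shows "dem_sq (w \<circ> adj j) = (if rdesc j (dem_sq w) then dem_sq w else twist j (dem_sq w))"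
  using assms by (simp add: dem_sq_step lstep_rstep_Invol dem_sq_Invol)

lemma rdesc_dem_sq:
  assumes "w \<in> S_inf" "0 < j" "w j > w (j + 1)"
  shows "rdesc j (dem_sq w)"
proof -
  have "rdesc j (dem_sq (w \<circ> adj j \<circ> adj j))"
    using assms by (subst dem_sq_comp_adj) (auto simp: adj_apply rdesc_twist dem_sq_Invol)
  then show ?thesis by simp
qed

lemma len_adj_comp:
  assumes "w \<in> S_inf" "0 < i" "inv w i < inv w (i + 1)"
  shows "len (adj i \<circ> w) = Suc (len w)"
proof -
  have "len (adj i \<circ> w) = len (inv w \<circ> adj i)"
    using len_inv_perm[of "adj i \<circ> w"] assms by (simp add: inv_adj_comp)
  also have "\<dots> = Suc (len (inv w))" using assms by (intro len_comp_adj) (auto simp: S_inf_inv)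
  finally show ?thesis using assms by (simp add: len_inv_perm)
qed

text \<open>Length plus number of 2-cycles grows by two: multiplication adds one inversion and one
  2-cycle, while conjugation adds two inversions and keeps the number of 2-cycles.\<close>

lemma len_inv_twist:
  assumes "0 < i" "z \<in> Invol" "\<not> rdesc i z"
  shows "len_inv (twist i z) = Suc (len_inv z)"
proof -
  let ?C = "\<lambda>z :: int \<Rightarrow> int. {a. 0 < a \<and> a < z a}"
  have S: "z \<in> S_inf" using assms Invol_S_inf by blast
  have "z i \<noteq> z (i + 1)" using S S_inf_inj by simp
  then have asc: "z i < z (i + 1)" using assms by (simp add: rdesc_def)
  have fin: "finite (?C z)"
    using S by (rule_tac finite_subset[of _ "{i. z i \<noteq> i}"]) (auto simp: S_inf_def)
  have l: "len (z \<circ> adj i) = Suc (len z)" using S asc by (rule len_comp_adj)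
  have "len (twist i z) + card (?C (twist i z)) = Suc (Suc (len z + card (?C z)))"
  proof (cases "adj i \<circ> z = z \<circ> adj i")
    case True
    then have z: "z i = i" "z (i + 1) = i + 1" using commute_iff[OF assms(2)] asc by auto
    have "?C (z \<circ> adj i) = insert i (?C z)"
      using assms(1) z by (auto simp: adj_apply split: if_splits)
    moreover have "i \<notin> ?C z" using z by simp
    ultimately show ?thesis using True fin l by (simp add: twist_def del: o_apply)
  next
    case False
    have pos: "0 < adj i a \<longleftrightarrow> 0 < a" for a using assms(1) by (auto simp: adj_apply)
    have less: "adj i a < adj i (z a) \<longleftrightarrow> a < z a" for a
    proof (rule adj_less_iff)
      show "\<not> (a = i \<and> z a = i + 1)"
        using asc Invol_Invol[OF assms(2), of i] by auto
      show "\<not> (a = i + 1 \<and> z a = i)"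
        using asc Invol_Invol[OF assms(2), of "i + 1"] by auto
    qed
    have "?C (adj i \<circ> z \<circ> adj i) = adj i ` ?C z"
    proof (intro equalityI subsetI)
      fix a assume "a \<in> ?C (adj i \<circ> z \<circ> adj i)"
      then have "adj i a \<in> ?C z" using less[of "adj i a"] pos[of a] by simp
      then have "adj i (adj i a) \<in> adj i ` ?C z" by (rule imageI)
      then show "a \<in> adj i ` ?C z" by simp
    qed (auto simp: less pos)
    then have c: "card (?C (adj i \<circ> z \<circ> adj i)) = card (?C z)"
      using inj_adj by (simp add: card_image inj_on_subset del: o_apply)
    have "inv (z \<circ> adj i) = adj i \<circ> z"
      using assms by (simp add: inv_comp_adj Invol_S_inf Invol_inv)
    moreover have "adj i (z i) < adj i (z (i + 1))"
      using asc False commute_iff[OF assms(2)] by (subst adj_less_iff) auto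
    ultimately have "len (adj i \<circ> (z \<circ> adj i)) = Suc (len (z \<circ> adj i))"
      using S assms(1) by (intro len_adj_comp) auto
    then show ?thesis using False c l by (simp add: twist_def comp_assoc del: o_apply)
  qed
  then show ?thesis unfolding len_inv_def by simp
qed

interpretation M: graded_involutions Invol twist rdesc len_inv id
proof
  show "len_inv id = 0" by (simp add: len_inv_def)
  show "id \<in> Invol" by (simp add: Invol_def)
qed (simp_all add: twist_Invol twist_twist rdesc_twist len_inv_twist)

lemma len_inv_dem_sq_le: "w \<in> S_inf \<Longrightarrow> len_inv (dem_sq w) \<le> len w"
proof (induction w rule: S_inf_induct)
  case (step v j)
  then show ?case
    using dem_sq_Invol[of v] by (auto simp: dem_sq_comp_adj len_comp_adj len_inv_twist simp del: o_apply)
qed (simp add: dem_sq_id M.ell_e del: id_apply)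

section \<open>Support bounds and finiteness of the fibres\<close>

lemma twist_preserves:
  assumes "\<And>x. x \<le> k \<Longrightarrow> z x \<le> k" "j \<noteq> k" "x \<le> k"
  shows "twist j z x \<le> k"
proof -
  have s: "adj j x \<le> k" if "x \<le> k" for x using assms(2) that by (auto simp: adj_apply)
  show ?thesis using s assms by (simp add: twist_def)
qed

text \<open>Bounds the support of \<open>w\<close> by that of \<open>w\<^sup>-\<^sup>1 \<circ> w\<close>, so that \<^const>\<open>B_inv\<close> is finite.\<close>

lemma dem_sq_preserves:
  assumes "w \<in> S_inf" "\<And>x. x \<le> k \<Longrightarrow> dem_sq w x \<le> k" "x \<le> k"
  shows "w x \<le> k"
  using assms
proof (induction w arbitrary: x rule: S_inf_induct)
  case (step v j)
  let ?z = "dem_sq (v \<circ> adj j)"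
  have S: "v \<circ> adj j \<in> S_inf" using step by simp
  then have z: "?z \<in> Invol" by (rule dem_sq_Invol)
  have "rdesc j ?z" using step S by (intro rdesc_dem_sq) (auto simp: adj_apply)
  moreover have "?z k \<le> k" by (rule step.prems(1)) simp
  moreover have "\<not> ?z (k + 1) \<le> k"
  proof
    assume "?z (k + 1) \<le> k"
    then have "?z (?z (k + 1)) \<le> k" by (rule step.prems(1))
    then show False unfolding Invol_Invol[OF z] by simp
  qed
  ultimately have j: "j \<noteq> k" by (auto simp: rdesc_def)
  have "dem_sq v = ?z \<or> dem_sq v = twist j ?z"
    using step by (auto simp: dem_sq_comp_adj twist_twist)
  then have "dem_sq v y \<le> k" if "y \<le> k" for y
  proof -
    have "twist j ?z y \<le> k" by (rule twist_preserves[OF step.prems(1) j that])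
    then show ?thesis using \<open>dem_sq v = ?z \<or> dem_sq v = twist j ?z\<close> step.prems(1)[OF that] by metis
  qed
  then have "v y \<le> k" if "y \<le> k" for y using step.IH that by blast
  moreover have "adj j x \<le> k" using j step.prems(2) by (auto simp: adj_apply)
  ultimately show ?case by simp
qed simp

lemma B_inv_eq: "B_inv z = {w \<in> S_inf. dem_sq w = z}"
  by (simp add: B_inv_def dem_sq_def)

lemma B_inv_subset:
  assumes "z \<in> S_fin n" "0 \<le> n" shows "B_inv z \<subseteq> S_fin n"
proof
  fix w assume "w \<in> B_inv z"
  then have w: "w \<in> S_inf" "dem_sq w = z" by (auto simp: B_inv_eq)
  have p: "w x \<le> k" if "n \<le> k" "x \<le> k" for x k
  proof (rule dem_sq_preserves[OF w(1) _ that(2)])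
    fix x assume "x \<le> k"
    then show "dem_sq w x \<le> k"
      using w(2) that S_fin_fix[OF assms(1), of x] S_fin_range[OF assms(1), of x]
      by (cases "x \<in> {1..n}") auto
  qed
  have fixd: "w x = x" if "n < x" for x
  proof -
    \<comment> \<open>An injective self-map of a finite interval is onto, so \<open>x\<close> cannot
      be sent below itself.\<close>
    have "w ` {1..x - 1} \<subseteq> {1..x - 1}"
      using p[of "x - 1"] S_inf_pos[OF w(1)] that by (force simp: int_one_le_iff_zero_less)
    moreover have "inj_on w {1..x - 1}" using S_inf_inj[OF w(1)] by (simp add: inj_on_def)
    ultimately have "w ` {1..x - 1} = {1..x - 1}" by (intro endo_inj_surj) auto
    then have "w x \<notin> {1..x - 1}" using S_inf_inj[OF w(1)] by (metis atLeastAtMost_iff imageE less_irrefl zle_diff1_eq)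
    moreover have "w x \<le> x" using p[of x x] that by simp
    moreover have "0 < w x" using S_inf_pos[OF w(1)] that assms(2) by simp
    ultimately show ?thesis by auto
  qed
  have "w permutes {0<..}" using w by (simp add: S_inf_def)
  then have "w permutes {1..n}"
    by (rule permutes_superset) (auto intro: fixd)
  then show "w \<in> S_fin n" by (simp add: S_fin_def)
qed

lemma finite_B_inv: assumes "z \<in> S_inf" shows "finite (B_inv z)"
proof -
  obtain n where "1 \<le> n" "z \<in> S_fin n" using S_inf_in_S_fin assms by blast
  then show ?thesis using B_inv_subset[of z n] finite_S_fin finite_subset by auto
qed

section \<open>From permutations to involutions\<close>

text \<open>Push-forward of coefficient functions along \<open>dem_sq\<close>, weighted by
  \<open>beta\<close> to the excess length.\<close>

definition Phi :: "((int \<Rightarrow> int) \<Rightarrow> pol) \<Rightarrow> (int \<Rightarrow> int) \<Rightarrow> pol" where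
  "Phi m z = (\<Sum>w\<in>B_inv z. beta ^ (len w - len_inv z) * m w)"

lemma B_inv_empty: "z \<notin> Invol \<Longrightarrow> B_inv z = {}"
  using dem_sq_Invol by (auto simp: B_inv_eq)

lemma finite_fibre: "finite (B_inv z)"
  using B_inv_empty finite_B_inv Invol_S_inf by (cases "z \<in> Invol") auto

lemma B_inv_le: "w \<in> B_inv z \<Longrightarrow> len_inv z \<le> len w"
  using len_inv_dem_sq_le by (auto simp: B_inv_eq)

lemma B_inv_rdesc: "w \<in> B_inv z \<Longrightarrow> 0 < j \<Longrightarrow> rdesc j w \<Longrightarrow> rdesc j z"
  using rdesc_dem_sq by (auto simp: B_inv_eq rdesc_def)

lemma dem_sq_rmul:
  assumes "v \<in> S_inf" "0 < j" "\<not> rdesc j v"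
  shows "dem_sq (rmul j v) = (if rdesc j (dem_sq v) then dem_sq v else twist j (dem_sq v))"
proof -
  have "v j \<noteq> v (j + 1)" using assms S_inf_inj by simp
  then show ?thesis
    using assms dem_sq_comp_adj[of v j] by (simp add: rmul_def rdesc_def)
qed

text \<open>\<open>Phi\<close> is a module homomorphism: if \<open>j\<close> is a descent of \<open>z\<close>, the elements of \<open>B_inv z\<close> without descent at
  \<open>j\<close> and those of \<open>B_inv (twist j z)\<close> are exactly the \<open>w s\<^sub>j\<close> with \<open>w\<close> in \<open>B_inv z\<close> having one.\<close>

lemma Phi_U: "Phi (R.U j m) z = M.U j (Phi m) z"
proof (cases "0 < j \<and> z \<in> Invol")
  case False
  then show ?thesis by (auto simp: Phi_def M.U_def R.U_def B_inv_empty)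
next
  case True
  then have j: "0 < j" and z: "z \<in> Invol" by auto
  show ?thesis
  proof (cases "rdesc j z")
    case False
    then have "R.U j m w = 0" if "w \<in> B_inv z" for w
      using B_inv_rdesc[OF that j] by (auto simp: R.U_def)
    then show ?thesis using False by (simp add: Phi_def M.U_def)
  next
    case True
    define y where "y = twist j z"
    define A where "A = {w \<in> B_inv z. \<not> rdesc j w}"
    define D where "D = {w \<in> B_inv z. rdesc j w}"
    have y: "\<not> rdesc j y" "twist j y = z" "len_inv z = Suc (len_inv y)"
      using True z j len_inv_twist[of j y] by (auto simp: y_def rdesc_twist twist_twist twist_Invol)
    have B: "B_inv z = A \<union> D" "A \<inter> D = {}" by (auto simp: A_def D_def)
    have fin: "finite A" "finite D" using finite_fibre by (auto simp: A_def D_def)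
    have C_asc: "\<not> rdesc j v" if "v \<in> B_inv y" for v using B_inv_rdesc[OF that j] y by blast
    have "A \<inter> B_inv y = {}" using y True by (auto simp: A_def B_inv_eq)
    have S: "v \<in> S_inf" if "v \<in> A \<union> B_inv y" for v using that by (auto simp: A_def B_inv_eq)
    let ?e = "\<lambda>w. beta ^ (len w - len_inv z)"
    have "Phi (R.U j m) z = (\<Sum>w\<in>A. ?e w * R.U j m w) + (\<Sum>w\<in>D. ?e w * R.U j m w)"
      unfolding Phi_def B using fin B(2) by (rule sum.union_disjoint)
    also have "(\<Sum>w\<in>A. ?e w * R.U j m w) = 0"
      by (rule sum.neutral) (simp add: A_def R.U_def)
    also have "(\<Sum>w\<in>D. ?e w * R.U j m w) = (\<Sum>w\<in>D. ?e w * (beta * m w + m (rmul j w)))"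
      using j by (intro sum.cong) (auto simp: D_def B_inv_eq R.U_def)
    also have "\<dots> = beta * (\<Sum>w\<in>D. ?e w * m w) + (\<Sum>w\<in>D. ?e w * m (rmul j w))"
      by (simp add: distrib_left sum.distrib sum_distrib_left mult.left_commute)
    also have "(\<Sum>w\<in>D. ?e w * m (rmul j w)) = (\<Sum>v\<in>A \<union> B_inv y. ?e (rmul j v) * m v)"
    proof (rule sum.reindex_bij_witness[where i = "rmul j" and j = "rmul j"])
      fix w assume w: "w \<in> D"
      then have wS: "w \<in> S_inf" "dem_sq w = z" "rdesc j w" by (auto simp: D_def B_inv_eq)
      let ?v = "rmul j w"
      show v: "rmul j ?v = w" using wS j R.c_c by blast
      have vS: "?v \<in> S_inf" "\<not> rdesc j ?v" using wS j R.c_closed R.desc_c by blast+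
      have "z = (if rdesc j (dem_sq ?v) then dem_sq ?v else twist j (dem_sq ?v))"
        using dem_sq_rmul[OF vS(1) j vS(2)] wS by (simp only: v)
      then have "dem_sq ?v = z \<or> dem_sq ?v = y"
        unfolding y_def by (metis twist_twist)
      then show "?v \<in> A \<union> B_inv y" using vS by (auto simp: A_def B_inv_eq)
      show "?e (rmul j ?v) * m ?v = ?e w * m ?v" by (simp add: v)
    next
      fix v assume v: "v \<in> A \<union> B_inv y"
      show "rmul j (rmul j v) = v" using S[OF v] j R.c_c by blast
      have asc: "\<not> rdesc j v" using v C_asc by (auto simp: A_def)
      have "dem_sq (rmul j v) = z"
        using v dem_sq_rmul[OF S[OF v] j asc] True y by (auto simp: A_def B_inv_eq)
      then show "rmul j v \<in> D"
        using S[OF v] asc j R.c_closed R.desc_c by (auto simp: D_def B_inv_eq)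
    qed
    also have "\<dots> = (\<Sum>v\<in>A. ?e (rmul j v) * m v) + (\<Sum>v\<in>B_inv y. ?e (rmul j v) * m v)"
      using fin finite_fibre \<open>A \<inter> B_inv y = {}\<close> by (intro sum.union_disjoint)
    \<comment> \<open>On \<open>A\<close> the longer element \<open>rmul j v\<close> contributes one
      more \<open>beta\<close>; on \<open>B_inv y\<close> the larger value \<open>len_inv z\<close>
      compensates for the extra length.\<close>
    also have "(\<Sum>v\<in>A. ?e (rmul j v) * m v) = beta * (\<Sum>v\<in>A. ?e v * m v)"
    proof -
      have "?e (rmul j v) = beta * ?e v" if "v \<in> A" for v
      proof -
        have "len (rmul j v) = Suc (len v)"
          using that S j by (intro R.ell_c) (auto simp: A_def)
        moreover have "len_inv z \<le> len v" using that B_inv_le by (auto simp: A_def)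
        ultimately show ?thesis by (simp add: Suc_diff_le)
      qed
      then show ?thesis by (simp add: sum_distrib_left mult.assoc)
    qed
    also have "(\<Sum>v\<in>B_inv y. ?e (rmul j v) * m v) = Phi m y"
      unfolding Phi_def
    proof (rule sum.cong)
      fix v assume v: "v \<in> B_inv y"
      then have "len (rmul j v) = Suc (len v)" using S C_asc j by (intro R.ell_c) auto
      then show "?e (rmul j v) * m v = beta ^ (len v - len_inv y) * m v" using y by simp
    qed simp
    also have "0 + (beta * (\<Sum>w\<in>D. ?e w * m w) + (beta * (\<Sum>v\<in>A. ?e v * m v) + Phi m y)) =
      beta * Phi m z + Phi m y"
      unfolding Phi_def B using sum.union_disjoint[OF fin B(2), of "\<lambda>w. ?e w * m w"]
      by (simp add: algebra_simps)
    finally show ?thesis using j z True by (simp add: M.U_def y_def)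
  qed
qed

lemma Phi_H: "Phi (R.H i x m) = M.H i x (Phi m)"
proof
  fix z
  have "Phi (R.H i x m) z = Phi m z + x * Phi (R.U i m) z"
    by (simp add: Phi_def R.H_def R.K_def distrib_left sum.distrib sum_distrib_left mult.left_commute)
  then show "Phi (R.H i x m) z = M.H i x (Phi m) z" by (simp add: Phi_U M.H_def M.K_def)
qed

lemma Phi_act: "Phi (R.act L m) = M.act L (Phi m)"
proof (induction L arbitrary: m)
  case (Cons p L)
  then show ?case by (cases p) (simp add: Phi_H)
qed simp

lemma Phi_unit: "Phi R.unit = M.unit"
proof
  fix z
  have "Phi R.unit z = (\<Sum>w\<in>B_inv z. if w = id then beta ^ (len w - len_inv z) else 0)"
    unfolding Phi_def by (intro sum.cong) (auto simp: R.unit_def)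
  also have "\<dots> = (if id \<in> B_inv z then beta ^ (len id - len_inv z) else 0)"
    using finite_fibre by (simp add: sum.delta del: id_apply)
  also have "\<dots> = M.unit z" by (auto simp: B_inv_eq dem_sq_id M.unit_def)
  finally show "Phi R.unit z = M.unit z" .
qed

text \<open>Identities obtained from the braid relations for permutations pass through
  \<open>Phi\<close> to the involution module.\<close>

lemma act_transfer:
  "R.act L R.unit = R.act L' R.unit \<Longrightarrow> M.act L M.unit = M.act L' M.unit"
  using Phi_act[of L R.unit] Phi_act[of L' R.unit] by (simp add: Phi_unit)

lemma inv_grothendieck_Phi: "inv_grothendieck = Phi grothendieck"
  by (simp add: fun_eq_iff inv_grothendieck_def Phi_def)

lemma inv_grothendieck_rel:
  assumes "0 < i"
  shows "(1 + beta * X i) * swap_vars i (inv_grothendieck z) =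
    (1 + beta * X i) * inv_grothendieck z + (X (i + 1) - X i) * M.U i inv_grothendieck z"
proof -
  let ?e = "\<lambda>w. beta ^ (len w - len_inv z)"
  let ?G = grothendieck
  have "(1 + beta * X i) * swap_vars i (inv_grothendieck z) =
    (\<Sum>w\<in>B_inv z. ?e w * ((1 + beta * X i) * swap_vars i (?G w)))"
    by (simp add: inv_grothendieck_def swap_vars_sum swap_vars_mult swap_vars_power
      sum_distrib_left mult.left_commute)
  also have "\<dots> = (\<Sum>w\<in>B_inv z. ?e w * ((1 + beta * X i) * ?G w + (X (i + 1) - X i) * R.U i ?G w))"
    using assms by (intro sum.cong) (auto simp: grothendieck_rel B_inv_eq)
  also have "\<dots> = (1 + beta * X i) * Phi ?G z + (X (i + 1) - X i) * Phi (R.U i ?G) z"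
    unfolding Phi_def distrib_left sum.distrib sum_distrib_left by (simp only: mult.left_commute)
  finally show ?thesis by (simp add: Phi_U inv_grothendieck_Phi)
qed

lemma inv_grothendieck_eq_act:
  assumes "z \<in> S_fin n" "1 \<le> n"
  shows "inv_grothendieck z = M.act (rows n 1 X) M.unit z"
proof -
  have "inv_grothendieck z = Phi (fk n) z"
    unfolding inv_grothendieck_Phi Phi_def
    using B_inv_subset[OF assms(1)] assms(2) grothendieck_eq_fk by (intro sum.cong) auto
  then show ?thesis by (simp add: fk_def Phi_act Phi_unit)
qed

section \<open>Reflection equation and reversal of a row\<close>

definition point :: "(int \<Rightarrow> int) \<Rightarrow> (int \<Rightarrow> int) \<Rightarrow> pol" where
  "point y z = (if z = y then 1 else 0)"

lemma M_U_point:
  assumes "0 < i" "y \<in> Invol" "\<not> rdesc i y"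
  shows "M.U i (point y) = point (twist i y)"
proof
  fix z
  have "twist i z = y \<longleftrightarrow> z = twist i y" by (metis twist_twist)
  moreover have "rdesc i (twist i y)" "twist i y \<in> Invol"
    using assms by (simp_all add: rdesc_twist twist_Invol)
  ultimately show "M.U i (point y) z = point (twist i y) z"
    using assms by (metis (no_types, lifting) M.U_def add_0 mult_zero_right point_def)
qed

lemma id_Invol: "id \<in> Invol"
  by (rule M.e_in)

lemma twist_id: "twist i id = adj i"
  by (simp add: twist_def)

lemma twist_adj_Suc: "twist (i + 1) (adj i) = twist i (adj (i + 1))"
proof -
  have "(adj (i + 1) \<circ> adj i) i \<noteq> (adj i \<circ> adj (i + 1)) i" by (simp add: adj_apply)
  then have "adj (i + 1) \<circ> adj i \<noteq> adj i \<circ> adj (i + 1)" by metis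
  then show ?thesis using adj_braid[of i] by (simp add: twist_def)
qed

text \<open>The reflection equation: on the involution module, two consecutive factors with the same
  parameter may be exchanged at the left end.\<close>

lemma reflection:
  assumes "0 < i"
  shows "M.act [(i, x), (i + 1, x)] M.unit = M.act [(i + 1, x), (i, x)] M.unit"
proof -
  have a: "adj i \<in> Invol" "adj (i + 1) \<in> Invol"
    using assms S_inf_adj[of i] S_inf_adj[of "i + 1"] by (auto simp: Invol_def)
  have asc: "\<not> rdesc i id" "\<not> rdesc (i + 1) id" "\<not> rdesc (i + 1) (adj i)" "\<not> rdesc i (adj (i + 1))"
    by (auto simp: rdesc_def adj_apply)
  have U: "M.U i (point id) = point (adj i)" "M.U (i + 1) (point id) = point (adj (i + 1))"
    "M.U (i + 1) (point (adj i)) = point (twist (i + 1) (adj i))"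
    "M.U i (point (adj (i + 1))) = point (twist (i + 1) (adj i))"
    using M_U_point[OF _ id_Invol asc(1)] M_U_point[OF _ id_Invol asc(2)]
      M_U_point[OF _ a(1) asc(3)] M_U_point[OF _ a(2) asc(4)] assms
    by (simp_all add: twist_id twist_adj_Suc del: id_apply)
  have u: "M.unit = point id" by (simp add: fun_eq_iff M.unit_def point_def)
  have H: "M.act [(j, x), (k, x)] M.unit z = point id z + x * M.U j (point id) z +
    x * (M.U k (point id) z + x * M.U k (M.U j (point id)) z)" for j k z
    unfolding u by (simp add: M.H_def M.K_eq M.U_add M.U_scale del: id_apply)
  show ?thesis by (rule ext) (simp only: H U, simp only: algebra_simps)
qed

lemma row_Suc: "a \<le> n \<Longrightarrow> row (n + 1) a x = (n, x) # row n a x"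
  by (simp add: row_def upto_rec2)

lemma row_rev_Suc: "a \<le> n \<Longrightarrow> row_rev (n + 1) a x = row_rev n a x @ [(n, x)]"
  by (simp add: row_rev_def upto_rec2)

text \<open>The reflection equation exchanges the two leading factors. The one with the largest
  index then commutes past the lower ones to the end, and induction treats the remaining
  row.\<close>

lemma act_row_reverse:
  assumes "0 < a"
  shows "M.act (row n a x) M.unit = M.act (row_rev n a x) M.unit"
proof (cases "a < n")
  case True
  then have "a + 1 \<le> n" by simp
  then show ?thesis
  proof (induction n rule: int_ge_induct)
    case base
    show ?case by (simp add: row_rec row_rev_rec)
  next
    case (step n)
    obtain k where n: "n = k + 1" by (metis diff_add_cancel)
    have k: "a \<le> k" "0 < k" using step n assms by auto
    have "M.act (row (n + 1) a x) M.unit = M.act (row k a x) (M.act [(k + 1, x), (k, x)] M.unit)"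
      using k row_Suc[of a "k + 1" x] row_Suc[of a k x] unfolding n by simp
    also have "\<dots> = M.act (row k a x) (M.act [(k, x), (k + 1, x)] M.unit)"
      using reflection[OF k(2)] by simp
    also have "\<dots> = M.act ([(k, x), (k + 1, x)] @ row k a x) M.unit" by simp
    also have "\<dots> = M.act ([(k, x)] @ row k a x @ [(k + 1, x)]) M.unit"
    proof (rule act_transfer)
      have "R.act (row k a x) (R.H (k + 1) x m) = R.H (k + 1) x (R.act (row k a x) m)" for m
        by (intro act_H) (auto dest: set_row)
      then show "R.act ([(k, x), (k + 1, x)] @ row k a x) R.unit =
        R.act ([(k, x)] @ row k a x @ [(k + 1, x)]) R.unit" by simp
    qed
    also have "\<dots> = M.act [(n, x)] (M.act (row n a x) M.unit)"
      using k by (simp add: n row_Suc)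
    also have "\<dots> = M.act (row_rev (n + 1) a x) M.unit"
      using step k by (simp add: row_rev_Suc del: id_apply)
    finally show ?case .
  qed
qed simp

text \<open>The two factors at index \<open>n - 1\<close> merge by \<open>H_H\<close>; the
  Yang--Baxter equation carries the merged factor down to index \<open>b\<close> while the two rows
  change places.\<close>

lemma row_rev_row:
  assumes "0 < b" "b < n"
  shows "R.act (row_rev n b x @ row n b y) m =
    R.act (row n (b + 1) y @ [(b, oplus x y)] @ row_rev n (b + 1) x) m"
  using assms
proof (induction b arbitrary: m rule: downward_induct[of n])
  case (step b)
  show ?case
  proof (cases "b + 1 < n")
    case False
    then show ?thesis using step.prems by (simp add: row_rec row_rev_rec R.H_H)
  next
    case True
    let ?A = "R.act (row n (b + 2) y)" and ?B = "R.act (row_rev n (b + 2) x)"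
    have c: "?A (R.H b z m) = R.H b z (?A m)" "?B (R.H b z m) = R.H b z (?B m)" for z m
      by (intro act_H; auto dest: set_row set_row_rev)+
    have r: "row n (b + 1) y = row n (b + 2) y @ [(b + 1, y)]"
      "row_rev n (b + 1) x = (b + 1, x) # row_rev n (b + 2) x"
      using row_rec[OF True] row_rev_rec[OF True] by (simp_all add: add.assoc)
    have IH: "R.act (row_rev n (b + 1) x @ row n (b + 1) y) m =
      ?B (R.H (b + 1) (oplus x y) (?A m))" for m
      using step True by (simp add: add.assoc)
    have "R.act (row_rev n b x @ row n b y) m =
        R.H b y (R.act (row_rev n (b + 1) x @ row n (b + 1) y) (R.H b x m))"
      using step.prems by (simp add: row_rec[of b] row_rev_rec[of b])
    also have "\<dots> = ?B (R.H b y (R.H (b + 1) (oplus x y) (R.H b x (?A m))))"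
      by (simp only: IH c)
    also have "\<dots> = ?B (R.H (b + 1) x (R.H b (oplus x y) (R.H (b + 1) y (?A m))))"
      using step.prems by (simp only: yang_baxter)
    finally show ?thesis by (simp add: r)
  qed
qed simp

text \<open>The increasing row passes through all rows. Each of them leaves one merged factor behind
  and loses its lowest generator, which explains the shifted parameters
  \<open>y (k - 1)\<close>.\<close>

lemma row_rev_rows:
  assumes "0 < b"
  shows "R.act (row_rev n b x @ rows n b y) m =
    R.act (rows n (b + 1) (\<lambda>k. y (k - 1)) @ map (\<lambda>k. (k, oplus x (y k))) [b..n - 1]) m"
  using assms
proof (induction b arbitrary: m rule: downward_induct[of n])
  case (step b)
  let ?y = "\<lambda>k. y (k - 1)"
  let ?L = "\<lambda>b. map (\<lambda>k. (k, oplus x (y k))) [b..n - 1]"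
  have c: "R.act (rows n (b + 1 + 1) ?y) (R.H b z m) = R.H b z (R.act (rows n (b + 1 + 1) ?y) m)" for z m
    by (intro act_H) (auto dest: set_rows)
  have "R.act (row_rev n b x @ rows n b y) m =
      R.act (rows n (b + 1) y) (R.act (row_rev n b x @ row n b (y b)) m)"
    by (simp add: rows_step[of n b])
  also have "\<dots> = R.act (row_rev n (b + 1) x @ rows n (b + 1) y)
      (R.H b (oplus x (y b)) (R.act (row n (b + 1) (y b)) m))"
    using row_rev_row[OF step.prems step.hyps, of x "y b" m] by simp
  also have "\<dots> = R.act (rows n (b + 1 + 1) ?y @ ?L (b + 1))
      (R.H b (oplus x (y b)) (R.act (row n (b + 1) (y b)) m))"
    using step.prems by (intro step.IH) simp
  also have "\<dots> = R.act (?L (b + 1)) (R.H b (oplus x (y b)) (R.act (rows n (b + 1 + 1) ?y)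
      (R.act (row n (b + 1) (y b)) m)))"
    by (simp only: R.act_append c)
  also have "\<dots> = R.act (rows n (b + 1) ?y @ ?L b) m"
    using step.hyps by (simp add: rows_step[of n "b + 1"] upto_rec1[of b])
  finally show ?case .
qed simp

lemma act_rows_reduce:
  assumes "0 < a" "a < n"
  shows "M.act (rows n a y) M.unit =
    M.act (rows n (a + 2) (\<lambda>k. y (k - 1)) @ [(a, y a)] @
      map (\<lambda>k. (k, oplus (y a) (y k))) [a + 1..n - 1]) M.unit"
proof -
  have "M.act (rows n a y) M.unit = M.act (row_rev n a (y a) @ rows n (a + 1) y) M.unit"
    using act_row_reverse[OF assms(1), of n "y a"] by (simp add: rows_step[of n a])
  also have "\<dots> = M.act (rows n (a + 2) (\<lambda>k. y (k - 1)) @ [(a, y a)] @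
      map (\<lambda>k. (k, oplus (y a) (y k))) [a + 1..n - 1]) M.unit"
  proof (rule act_transfer)
    \<comment> \<open>The leading factor at \<open>a\<close> is set aside while the rest of its row
      passes through; it commutes with all indices from \<open>a + 2\<close> on.\<close>
    have c: "R.act (rows n (a + 2) y') (R.H a z m) = R.H a z (R.act (rows n (a + 2) y') m)" for y' z m
      by (intro act_H) (auto dest: set_rows)
    have "R.act (row_rev n a (y a) @ rows n (a + 1) y) R.unit =
      R.act (row_rev n (a + 1) (y a) @ rows n (a + 1) y) (R.H a (y a) R.unit)"
      using assms by (simp add: row_rev_rec)
    also have "\<dots> = R.act (rows n (a + 1 + 1) (\<lambda>k. y (k - 1)) @
      map (\<lambda>k. (k, oplus (y a) (y k))) [a + 1..n - 1]) (R.H a (y a) R.unit)"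
      using assms by (intro row_rev_rows) simp
    finally show "R.act (row_rev n a (y a) @ rows n (a + 1) y) R.unit =
      R.act (rows n (a + 2) (\<lambda>k. y (k - 1)) @ [(a, y a)] @
        map (\<lambda>k. (k, oplus (y a) (y k))) [a + 1..n - 1]) R.unit"
      by (simp add: c add.assoc)
  qed
  finally show ?thesis .
qed

section \<open>The longest element\<close>

text \<open>The box \<open>(i, j)\<close> with \<open>t < i \<le> j\<close> and \<open>i + j \<le> n\<close> contributes the generator with index
  \<open>i + j - 1\<close>, and its parameter is the corresponding factor of the product formula.\<close>

function half :: "int \<Rightarrow> int \<Rightarrow> (int \<times> pol) list" where
  "half n t = (if 2 * t + 1 < n
    then half n (t + 1) @ (2 * t + 1, X (t + 1)) #
      map (\<lambda>k. (k, oplus (X (t + 1)) (X (k - t)))) [2 * t + 2..n - 1]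
    else [])"
  by auto
termination by (relation "measure (\<lambda>(n, t). nat (n - 2 * t))") auto

declare half.simps [simp del]

lemma half_step:
  "2 * t + 1 < n \<Longrightarrow> half n t = half n (t + 1) @ (2 * t + 1, X (t + 1)) #
    map (\<lambda>k. (k, oplus (X (t + 1)) (X (k - t)))) [2 * t + 2..n - 1]"
  by (simp add: half.simps[of n t])

lemma half_Nil: "n \<le> 2 * t + 1 \<Longrightarrow> half n t = []"
  by (simp add: half.simps[of n t])

text \<open>Each use of \<open>act_rows_reduce\<close> raises the first index by two and shifts the
  parameters by one; hence the start \<open>2 * t + 1\<close> and the shift
  \<open>t\<close>.\<close>

lemma act_half:
  "0 \<le> t \<Longrightarrow> M.act (rows n (2 * t + 1) (\<lambda>k. X (k - t))) M.unit = M.act (half n t) M.unit"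
proof (induction n t rule: half.induct)
  case (1 n t)
  show ?case
  proof (cases "2 * t + 1 < n")
    case True
    have "M.act (rows n (2 * t + 1 + 2) (\<lambda>k. X (k - 1 - t))) M.unit = M.act (half n (t + 1)) M.unit"
      using 1 True by (simp add: algebra_simps del: id_apply)
    then show ?thesis
      using act_rows_reduce[of "2 * t + 1" n "\<lambda>k. X (k - t)"] True 1(2)
      by (simp add: half_step add.commute[of "2 * t" 2] del: id_apply)
  qed (simp add: half_Nil)
qed

text \<open>The partner of \<open>a\<close> moves from \<open>b\<close> up to \<open>n\<close>. Its
  value \<open>a\<close> stays below all later values, so every twist is a conjugation at an
  ascent.\<close>

lemma fold_twist_cycle:
  assumes "z \<in> Invol" "z b = a" "0 < a" "a < b" "b \<le> n" "\<And>k. b < k \<Longrightarrow> a < z k"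
  shows "fold twist [b..n - 1] z =
      (\<lambda>k. if k = b then n else if b < k \<and> k \<le> n then k - 1 else k) \<circ> z \<circ>
      (\<lambda>k. if k = n then b else if b \<le> k \<and> k < n then k + 1 else k) \<and>
    len_inv (fold twist [b..n - 1] z) = len_inv z + nat (n - b)"
  using assms
proof (induction b arbitrary: z rule: downward_induct[of n])
  case (base b)
  then have "b = n" by simp
  then show ?case by (auto simp: fun_eq_iff)
next
  case (step b)
  let ?d = "\<lambda>b k. if k = b then n else if b < k \<and> k \<le> n then k - 1 else k"
  let ?d' = "\<lambda>b k. if k = n then b else if b \<le> k \<and> k < n then k + 1 else k"
  have t: "twist b z = adj b \<circ> z \<circ> adj b"
    using step.prems commute_iff[of z b] by (auto simp: twist_def)
  have asc: "\<not> rdesc b z" using step.prems(2) step.prems(6)[of "b + 1"] by (simp add: rdesc_def)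
  have "a < twist b z k" if "b + 1 < k" for k
  proof -
    have "a < z k" using step.prems(6)[of k] that by simp
    then have "a < adj b (z k)" using step.prems(4) by (auto simp: adj_apply)
    then show ?thesis using that by (simp add: t adj_apply)
  qed
  moreover have "twist b z (b + 1) = a" using step.prems by (simp add: t adj_apply)
  ultimately have IH: "fold twist [b + 1..n - 1] (twist b z) = ?d (b + 1) \<circ> twist b z \<circ> ?d' (b + 1) \<and>
    len_inv (fold twist [b + 1..n - 1] (twist b z)) = len_inv (twist b z) + nat (n - (b + 1))"
    using step.prems step.hyps by (intro step.IH twist_Invol) auto
  have f: "fold twist [b..n - 1] z = fold twist [b + 1..n - 1] (twist b z)"
    using step.hyps by (simp add: upto_rec1[of b])
  have d: "?d (b + 1) (adj b k) = ?d b k" for k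
    using step.hyps by (auto simp: adj_apply)
  have d': "adj b (?d' (b + 1) k) = ?d' b k" for k
    using step.hyps by (auto simp: adj_apply)
  have "?d (b + 1) \<circ> twist b z \<circ> ?d' (b + 1) = ?d b \<circ> z \<circ> ?d' b"
  proof
    fix k
    have "(?d (b + 1) \<circ> twist b z \<circ> ?d' (b + 1)) k = ?d (b + 1) (adj b (z (adj b (?d' (b + 1) k))))"
      by (simp only: t o_apply)
    also have "\<dots> = (?d b \<circ> z \<circ> ?d' b) k" unfolding d d' by (simp only: o_apply)
    finally show "(?d (b + 1) \<circ> twist b z \<circ> ?d' (b + 1)) k = (?d b \<circ> z \<circ> ?d' b) k" .
  qed
  then have "fold twist [b..n - 1] z = ?d b \<circ> z \<circ> ?d' b"
    using conjunct1[OF IH] unfolding f by (rule trans[rotated])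
  moreover have "len_inv (twist b z) = Suc (len_inv z)"
    using step.prems asc by (intro len_inv_twist) auto
  then have "len_inv (fold twist [b..n - 1] z) = len_inv z + nat (n - b)"
    using conjunct2[OF IH] step.hyps unfolding f by simp
  ultimately show ?case by (rule conjI)
qed

definition reversal :: "int \<Rightarrow> int \<Rightarrow> int \<Rightarrow> int" where
  "reversal a n k = (if a \<le> k \<and> k \<le> n then n + a - k else k)"

lemma set_half: "(j, x) \<in> set (half n t) \<Longrightarrow> 0 \<le> t \<Longrightarrow> 0 < j"
proof (induction n t rule: half.induct)
  case (1 n t)
  show ?case
  proof (cases "2 * t + 1 < n")
    case True
    then show ?thesis using 1 by (auto simp: half_step)
  next
    case False
    then show ?thesis using 1(2) by (simp add: half_Nil)
  qed
qed

text \<open>The letter \<open>2 * t + 1\<close> adds the 2-cycle of \<open>2 * t + 1\<close> and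
  \<open>2 * t + 2\<close> to the inner reversal, and the following letters carry its upper point to
  \<open>n\<close>. Every letter raises the rank.\<close>

lemma walk_half:
  "0 \<le> t \<Longrightarrow> M.walk (map fst (half n t)) = reversal (2 * t + 1) n \<and>
    len_inv (reversal (2 * t + 1) n) = length (half n t)"
proof (induction n t rule: half.induct)
  case (1 n t)
  show ?case
  proof (cases "2 * t + 1 < n")
    case False
    then have "reversal (2 * t + 1) n = id" by (auto simp: reversal_def fun_eq_iff)
    moreover have "M.walk [] = id" by (simp add: M.walk_def)
    ultimately show ?thesis using False by (simp add: half_Nil M.ell_e del: id_apply)
  next
    case True
    let ?a = "2 * t + 1"
    let ?r = "reversal (?a + 2) n"
    have IH: "M.walk (map fst (half n (t + 1))) = ?r" "len_inv ?r = length (half n (t + 1))"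
      using 1 True by (simp_all add: algebra_simps id_def)
    have r: "?r \<in> Invol"
    proof -
      have "\<forall>i\<in>set (map fst (half n (t + 1))). 0 < i"
        using 1(2) set_half[of _ _ n "t + 1"] by auto
      then show ?thesis using M.walk_in IH(1) by metis
    qed
    have fixd: "?r ?a = ?a" "?r (?a + 1) = ?a + 1" by (simp_all add: reversal_def)
    have tw: "twist ?a ?r = ?r \<circ> adj ?a"
      using commute_iff[OF r, of ?a] fixd by (simp add: twist_def)
    have tw_in: "?r \<circ> adj ?a \<in> Invol" using twist_Invol[OF _ r, of ?a] tw 1(2) by simp
    have l: "len_inv (?r \<circ> adj ?a) = Suc (len_inv ?r)"
      unfolding tw[symmetric]
    proof (rule len_inv_twist[OF _ r])
      show "\<not> rdesc ?a ?r" unfolding rdesc_def fixd by simp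
    qed (use 1(2) in simp)
    have cyc: "fold twist [?a + 1..n - 1] (?r \<circ> adj ?a) =
        (\<lambda>k. if k = ?a + 1 then n else if ?a + 1 < k \<and> k \<le> n then k - 1 else k) \<circ> (?r \<circ> adj ?a) \<circ>
        (\<lambda>k. if k = n then ?a + 1 else if ?a + 1 \<le> k \<and> k < n then k + 1 else k) \<and>
      len_inv (fold twist [?a + 1..n - 1] (?r \<circ> adj ?a)) = len_inv (?r \<circ> adj ?a) + nat (n - (?a + 1))"
    proof (rule fold_twist_cycle[OF tw_in, where a = ?a])
      show "?a < (?r \<circ> adj ?a) k" if "?a + 1 < k" for k
        using that by (auto simp: adj_apply reversal_def)
    qed (use fixd True 1(2) in \<open>auto simp: adj_apply\<close>)
    have "(\<lambda>k. if k = ?a + 1 then n else if ?a + 1 < k \<and> k \<le> n then k - 1 else k) \<circ> (?r \<circ> adj ?a) \<circ>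
        (\<lambda>k. if k = n then ?a + 1 else if ?a + 1 \<le> k \<and> k < n then k + 1 else k) = reversal ?a n"
    proof
      fix k
      consider "k = ?a" | "k = n" | "?a < k" "k < n" | "k < ?a" | "n < k" by linarith
      then show "((\<lambda>k. if k = ?a + 1 then n else if ?a + 1 < k \<and> k \<le> n then k - 1 else k) \<circ> (?r \<circ> adj ?a) \<circ>
        (\<lambda>k. if k = n then ?a + 1 else if ?a + 1 \<le> k \<and> k < n then k + 1 else k)) k = reversal ?a n k"
        using True by cases (auto simp: adj_apply reversal_def)
    qed
    with conjunct1[OF cyc] have c1: "fold twist [?a + 1..n - 1] (?r \<circ> adj ?a) = reversal ?a n"
      by (rule trans)
    have c2: "len_inv (reversal ?a n) = len_inv (?r \<circ> adj ?a) + nat (n - (?a + 1))"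
      using conjunct2[OF cyc] unfolding c1 .
    have "map fst (half n t) = map fst (half n (t + 1)) @ ?a # [?a + 1..n - 1]"
      using True by (simp add: half_step o_def add.commute[of "2 * t" 2])
    then have "M.walk (map fst (half n t)) = fold twist [?a + 1..n - 1] (twist ?a ?r)"
      using IH(1) by (simp add: M.walk_def)
    moreover have "length (half n t) = length (half n (t + 1)) + Suc (nat (n - (?a + 1)))"
      using True by (simp add: half_step)
    ultimately show ?thesis using c1 c2 l IH(2) tw by (simp del: id_apply)
  qed
qed

definition weight :: "int \<Rightarrow> int \<Rightarrow> pol" where
  "weight i j = (if i = j then X i else oplus (X i) (X j))"

lemma prod_list_map_upto: "prod_list (map f [a..b]) = (\<Prod>k = a..b. f k)"
  using prod.distinct_set_conv_list[of "[a..b]" f] by simp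

lemma prod_half:
  "0 \<le> t \<Longrightarrow> prod_list (map snd (half n t)) =
    (\<Prod>(i, j)\<in>{(i, j). t < i \<and> i \<le> j \<and> i + j \<le> n}. weight i j)"
proof (induction n t rule: half.induct)
  case (1 n t)
  let ?S = "\<lambda>t. {(i, j). t < i \<and> i \<le> j \<and> i + j \<le> n}"
  show ?case
  proof (cases "2 * t + 1 < n")
    case False
    then have "?S t = {}" by auto
    then show ?thesis using False by (simp only: half_Nil) simp
  next
    case True
    have fin: "finite (?S (t + 1))"
      using 1(2) by (rule_tac finite_subset[of _ "{0..n} \<times> {0..n}"]) auto
    have S: "?S t = insert (t + 1, t + 1) (Pair (t + 1) ` {t + 2..n - 1 - t} \<union> ?S (t + 1))"
      using True 1(2) by (auto simp: image_iff)
    have disj: "Pair (t + 1) ` {t + 2..n - 1 - t} \<inter> ?S (t + 1) = {}"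
      "(t + 1, t + 1) \<notin> Pair (t + 1) ` {t + 2..n - 1 - t} \<union> ?S (t + 1)" by auto
    have "(\<Prod>(i, j)\<in>?S t. weight i j) =
      X (t + 1) * ((\<Prod>(i, j)\<in>Pair (t + 1) ` {t + 2..n - 1 - t}. weight i j) *
        (\<Prod>(i, j)\<in>?S (t + 1). weight i j))"
      unfolding S using fin disj by (simp add: prod.union_disjoint weight_def)
    also have "(\<Prod>(i, j)\<in>Pair (t + 1) ` {t + 2..n - 1 - t}. weight i j) =
        (\<Prod>j = t + 2..n - 1 - t. oplus (X (t + 1)) (X j))"
      by (subst prod.reindex) (auto simp: inj_on_def weight_def)
    \<comment> \<open>The box \<open>(t + 1, j)\<close> belongs to the generator with index
      \<open>j + t\<close>.\<close>
    also have "\<dots> = (\<Prod>k = 2 * t + 2..n - 1. oplus (X (t + 1)) (X (k - t)))"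
      by (rule prod.reindex_bij_witness[where i = "\<lambda>k. k - t" and j = "\<lambda>j. j + t"]) auto
    also have "(\<Prod>(i, j)\<in>?S (t + 1). weight i j) = prod_list (map snd (half n (t + 1)))"
      using 1 True by simp
    finally show ?thesis
      using True by (simp add: half_step o_def prod_list_map_upto mult_ac)
  qed
qed

lemma inv_grothendieck_longest:
  assumes "1 \<le> n"
  shows "inv_grothendieck (longest n) =
    (\<Prod>(i, j)\<in>{(i, j). 0 < i \<and> i \<le> j \<and> i + j \<le> n}. weight i j)"
proof -
  have r: "reversal 1 n = longest n" by (simp add: fun_eq_iff reversal_def longest_def)
  have "inv_grothendieck (longest n) = M.act (half n 0) M.unit (longest n)"
    using act_half[of 0 n] inv_grothendieck_eq_act[OF longest_S_fin assms] by simp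
  also have "\<dots> = prod_list (map snd (half n 0))"
    using M.act_unit_walk[of "half n 0"] walk_half[of 0 n] set_half[of _ _ n 0] by (auto simp: r)
  finally show ?thesis using prod_half[of 0 n] by simp
qed

section \<open>Dominant involutions\<close>

text \<open>For an involution this is the Rothe diagram, in a form that is visibly
  symmetric.\<close>

definition dgm :: "(int \<Rightarrow> int) \<Rightarrow> (int \<times> int) set" where
  "dgm z = {(i, j). 0 < i \<and> 0 < j \<and> i < z j \<and> j < z i}"

definition lower_set :: "(int \<times> int) set \<Rightarrow> bool" where
  "lower_set D \<longleftrightarrow> (\<forall>(i, j)\<in>D. \<forall>i' j'. 0 < i' \<and> i' \<le> i \<and> 0 < j' \<and> j' \<le> j \<longrightarrow> (i', j') \<in> D)"

definition half_product :: "(int \<times> int) set \<Rightarrow> pol" where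
  "half_product D = (\<Prod>(i, j)\<in>{(i, j). (i, j) \<in> D \<and> i \<le> j}. weight i j)"

lemma lower_setD:
  "lower_set D \<Longrightarrow> (i, j) \<in> D \<Longrightarrow> 0 < i' \<Longrightarrow> i' \<le> i \<Longrightarrow> 0 < j' \<Longrightarrow> j' \<le> j \<Longrightarrow> (i', j') \<in> D"
  unfolding lower_set_def by blast

lemma dgm_sym: "(i, j) \<in> dgm z \<longleftrightarrow> (j, i) \<in> dgm z"
  by (auto simp: dgm_def)

lemma dgm_bounded: assumes "z \<in> S_fin n" shows "dgm z \<subseteq> {1..n} \<times> {1..n}"
proof -
  have le: "i \<le> n" if "(i, j) \<in> dgm z" for i j
    using that S_fin_range[OF assms, of i] S_fin_fix[OF assms, of i]
      S_fin_range[OF assms, of j] S_fin_fix[OF assms, of j]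
    by (cases "i \<in> {1..n}"; cases "j \<in> {1..n}") (auto simp: dgm_def)
  show ?thesis
  proof
    fix x assume x: "x \<in> dgm z"
    obtain i j where ij: "x = (i, j)" by (cases x)
    then have "i \<le> n" "j \<le> n" using x le[of i j] le[of j i] dgm_sym[of i j z] by auto
    then show "x \<in> {1..n} \<times> {1..n}" using x by (auto simp: ij dgm_def)
  qed
qed

lemma finite_dgm: assumes "z \<in> S_fin n" shows "finite (dgm z)"
  by (rule finite_subset[OF dgm_bounded[OF assms]]) simp

lemma dgm_longest: "dgm (longest n) = {(i, j). 0 < i \<and> 0 < j \<and> i + j \<le> n}"
  by (auto simp: dgm_def longest_def split: if_splits)

lemma swap_vars_half_product:
  assumes "\<And>i j. (i, j) \<in> D \<longleftrightarrow> (j, i) \<in> D"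
    and "\<And>i j. (adj k i, adj k j) \<in> D \<longleftrightarrow> (i, j) \<in> D"
  shows "swap_vars k (half_product D) = half_product D"
proof -
  let ?H = "{(i, j). (i, j) \<in> D \<and> i \<le> j}"
  \<comment> \<open>A box is moved by \<open>s_k\<close> and, where necessary, reflected back above
    the diagonal.\<close>
  define f where "f = (\<lambda>(i, j). if adj k i \<le> adj k j then (adj k i, adj k j) else (adj k j, adj k i))"
  have sw: "swap_vars k (weight i j) = weight (adj k i) (adj k j)" for i j
    by (auto simp: weight_def oplus_def swap_vars_add swap_vars_mult inj_eq[OF inj_adj])
  have "swap_vars k (half_product D) = (\<Prod>(i, j)\<in>?H. weight (adj k i) (adj k j))"
    unfolding half_product_def swap_vars_prod by (intro prod.cong) (auto simp: sw)
  also have "\<dots> = half_product D"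
    unfolding half_product_def
  proof (rule prod.reindex_bij_witness[where i = f and j = f])
    fix x assume x: "x \<in> ?H"
    obtain i j where ij: "x = (i, j)" by (cases x)
    have D: "(adj k i, adj k j) \<in> D" "(adj k j, adj k i) \<in> D"
      using x assms unfolding ij by auto
    have neq: "\<not> j \<le> i" if "\<not> adj k i \<le> adj k j" using that x ij by (cases "i = j") auto
    then show "f (f x) = x" using x ij by (auto simp: f_def)
    then show "f (f x) = x" .
    show "f x \<in> ?H" using D by (auto simp: f_def ij)
    then show "f x \<in> ?H" .
    show "(case f x of (i, j) \<Rightarrow> weight i j) = (case x of (i, j) \<Rightarrow> weight (adj k i) (adj k j))"
      by (auto simp: f_def ij weight_def oplus_commute inj_eq[OF inj_adj])
  qed
  finally show ?thesis .
qed

section \<open>Adding boxes at the first ascent of a dominant involution\<close>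

lemma least_ascent:
  assumes "w \<in> S_fin n" "w \<noteq> longest n"
  obtains k where "0 < k" "k < n" "w k < w (k + 1)" "\<And>a b. 0 < a \<Longrightarrow> a < b \<Longrightarrow> b \<le> k \<Longrightarrow> w a > w b"
proof -
  let ?P = "\<lambda>m. 0 < int m \<and> int m < n \<and> w (int m) < w (int m + 1)"
  obtain i where "0 < i" "i < n" "w i < w (i + 1)" using S_fin_exists_asc assms by metis
  then have "?P (nat i)" by simp
  then have P: "?P (LEAST m. ?P m)" by (rule LeastI)
  define k where "k = int (LEAST m. ?P m)"
  have w: "w a \<noteq> w (a + 1)" for a
    using S_inf_inj[of w a "a + 1"] assms(1) S_fin_subset_S_inf by auto
  have desc: "- w a < - w (a + 1)" if "0 < a" "a < k" for a
  proof -
    have "\<not> ?P (nat a)" using that by (intro not_less_Least) (simp add: k_def)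
    then have "\<not> w a < w (a + 1)" using that P by (simp add: k_def)
    then show ?thesis using w[of a] by simp
  qed
  have "w a > w b" if "0 < a" "a < b" "b \<le> k" for a b
  proof -
    have "- w a + (b - a) \<le> - w b" using that desc
      by (intro strict_asc_mono[where n = k and w = "\<lambda>a. - w a"]) auto
    then show ?thesis using that by simp
  qed
  then show thesis using that[of k] P by (simp add: k_def)
qed

locale dominant_ascent =
  fixes z :: "int \<Rightarrow> int" and k :: int
  assumes z: "z \<in> Invol" and lower: "lower_set (dgm z)" and k: "0 < k"
    and asc: "z k < z (k + 1)"
    and decr: "\<And>a b. 0 < a \<Longrightarrow> a < b \<Longrightarrow> b \<le> k \<Longrightarrow> z a > z b"
begin

lemma zz: "z (z a) = a"
  using z by (rule Invol_Invol)

lemma eq_iff: "z a = b \<longleftrightarrow> a = z b"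
  using zz by metis

lemma pos: "0 < z a \<longleftrightarrow> 0 < a"
  using z Invol_S_inf S_inf_pos by blast

lemma zk_neq_Suc: "z k \<noteq> k + 1"
  using asc zz[of k] by auto

text \<open>Otherwise \<open>z (k + 1) > k + 1\<close> puts \<open>(k + 1, k + 1)\<close> and hence
  \<open>(k, k)\<close> into the diagram, contradicting \<open>z k = k\<close>.\<close>

lemma zk_eq: assumes "z k = k" shows "z (k + 1) = k + 1"
proof (rule ccontr)
  assume "z (k + 1) \<noteq> k + 1"
  then have "(k + 1, k + 1) \<in> dgm z" using asc assms k by (auto simp: dgm_def)
  then have "(k, k) \<in> dgm z" using lower_setD[OF lower] k by auto
  then show False using assms by (simp add: dgm_def)
qed

lemma twist_eq: "twist k z = (if z k = k then z \<circ> adj k else adj k \<circ> z \<circ> adj k)"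
  using zk_eq zk_neq_Suc commute_iff[OF z, of k] by (auto simp: twist_def)

text \<open>The ascent gives one inclusion and the lower set property the other. This yields the
  symmetry of the half product in the variables \<open>k\<close> and \<open>k + 1\<close>.\<close>

lemma row_eq: "(k, b) \<in> dgm z \<longleftrightarrow> (k + 1, b) \<in> dgm z"
proof
  assume b: "(k, b) \<in> dgm z"
  then have "z b \<noteq> k + 1" using asc by (auto simp: eq_iff dgm_def)
  then show "(k + 1, b) \<in> dgm z" using b asc by (auto simp: dgm_def)
next
  assume b: "(k + 1, b) \<in> dgm z"
  then have "0 < b" by (simp add: dgm_def)
  then show "(k, b) \<in> dgm z" using lower_setD[OF lower b, of k b] k by simp
qed

lemma adj_dgm: "(adj k a, adj k b) \<in> dgm z \<longleftrightarrow> (a, b) \<in> dgm z"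
proof -
  have r: "(adj k a, b) \<in> dgm z \<longleftrightarrow> (a, b) \<in> dgm z" for a b
    using row_eq by (auto simp: adj_apply)
  show ?thesis using r dgm_sym by metis
qed

lemma dgm_twist: "dgm (twist k z) = dgm z \<union> {(k, z k), (z k, k)}"
proof (cases "z k = k")
  case True
  then have zk: "z k = k" "z (k + 1) = k + 1" using zk_eq by auto
  have t: "twist k z a = (if a = k then k + 1 else if a = k + 1 then k else z a)" for a
    using zk by (simp add: twist_eq adj_apply)
  have "(a, b) \<in> dgm (twist k z) \<longleftrightarrow> (a, b) \<in> dgm z \<union> {(k, z k), (z k, k)}" for a b
    using k zk by (cases "a = k"; cases "a = k + 1"; cases "b = k"; cases "b = k + 1")
      (auto simp: dgm_def t)
  then show ?thesis by auto
next
  case False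
  have less: "adj k a < adj k (z b) \<longleftrightarrow> a < z b \<and> \<not> (a = k \<and> b = z (k + 1)) \<or> a = k + 1 \<and> b = z k" for a b
  proof -
    consider "a = k \<and> z b = k + 1" | "a = k + 1 \<and> z b = k"
      | "\<not> (a = k \<and> z b = k + 1)" "\<not> (a = k + 1 \<and> z b = k)" by blast
    then show ?thesis
    proof cases
      case 3
      then show ?thesis using adj_less_iff[of a k "z b"] by (auto simp: eq_iff zz)
    qed (auto simp: eq_iff adj_apply zz)
  qed
  have pos_adj: "0 < adj k a \<longleftrightarrow> 0 < a" for a using k by (auto simp: adj_apply)
  have "(adj k a, adj k b) \<in> dgm (twist k z) \<longleftrightarrow> (a, b) \<in> dgm z \<or> (a, b) = (k + 1, z k) \<or> (a, b) = (z k, k + 1)"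
    for a b
  proof -
    have "(adj k a, adj k b) \<in> dgm (twist k z) \<longleftrightarrow>
      0 < a \<and> 0 < b \<and> adj k a < adj k (z b) \<and> adj k b < adj k (z a)"
      using False by (simp add: dgm_def twist_eq pos_adj)
    also have "\<dots> \<longleftrightarrow> (a, b) \<in> dgm z \<or> (a, b) = (k + 1, z k) \<or> (a, b) = (z k, k + 1)"
      \<comment> \<open>The pair \<open>(k, z (k + 1))\<close> excluded in \<open>less\<close> is
        not a box, since \<open>z k < z (k + 1)\<close>; so no box is lost.\<close>
      unfolding less using asc k False zk_neq_Suc pos[of k] zz[of k] zz[of "k + 1"]
      by (auto simp: dgm_def)
    finally show ?thesis .
  qed
  note * = this
  have zk: "adj k (z k) = z k" using False zk_neq_Suc by (auto simp: adj_apply)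
  have "(a, b) \<in> dgm (twist k z) \<longleftrightarrow> (a, b) \<in> dgm z \<union> {(k, z k), (z k, k)}" for a b
  proof -
    have "adj k a = k + 1 \<longleftrightarrow> a = k" "adj k a = z k \<longleftrightarrow> a = z k" for a
      using zk False zk_neq_Suc by (auto simp: adj_apply)
    then show ?thesis using *[of "adj k a" "adj k b"] by (auto simp: adj_dgm)
  qed
  then show ?thesis by auto
qed

lemma new_notin: "(k, z k) \<notin> dgm z" "(z k, k) \<notin> dgm z"
  by (auto simp: dgm_def)

text \<open>The new box \<open>(k, z k)\<close> is an outer corner: as \<open>z\<close> decreases up
  to \<open>k\<close>, the boxes \<open>(a, z k)\<close> with \<open>a < k\<close> and
  \<open>(k, b)\<close> with \<open>b < z k\<close> are already present. Its transpose follows by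
  symmetry.\<close>

lemma lower_twist: "lower_set (dgm (twist k z))"
proof -
  have left: "(a, z k) \<in> dgm z" if "0 < a" "a < k" for a
    using decr[of a k] that k pos zz[of k] by (auto simp: dgm_def)
  have below: "(k, b) \<in> dgm z" if "0 < b" "b < z k" for b
  proof -
    have "\<not> z b < k"
    proof
      assume "z b < k"
      then have "z k < z (z b)" using that pos by (intro decr) auto
      then show False using that by (simp add: zz)
    qed
    moreover have "z b \<noteq> k" using that by (auto simp: eq_iff)
    ultimately show ?thesis using that k by (simp add: dgm_def)
  qed
  have new: "(a, b) \<in> dgm (twist k z)" if "0 < a" "a \<le> k" "0 < b" "b \<le> z k" for a b
  proof -
    have "(a, b) \<in> dgm z \<or> (a, b) = (k, z k)"
    proof (cases "a = k")
      case True
      then show ?thesis using below[of b] that by auto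
    next
      case False
      then show ?thesis using lower_setD[OF lower left[of a], of a b] that by auto
    qed
    then show ?thesis unfolding dgm_twist by auto
  qed
  have new': "(a, b) \<in> dgm (twist k z)" if "0 < a" "a \<le> z k" "0 < b" "b \<le> k" for a b
    using new[of b a] that dgm_sym by blast
  show ?thesis
    unfolding lower_set_def
  proof (intro ballI allI impI, clarify)
    fix i j i' j' assume ij: "(i, j) \<in> dgm (twist k z)" and le: "0 < i'" "i' \<le> i" "0 < j'" "j' \<le> j"
    from ij consider "(i, j) \<in> dgm z" | "(i, j) = (k, z k)" | "(i, j) = (z k, k)"
      unfolding dgm_twist by blast
    then show "(i', j') \<in> dgm (twist k z)"
    proof cases
      case 1
      then show ?thesis using lower_setD[OF lower] le unfolding dgm_twist by blast
    qed (use new new' le in auto)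
  qed
qed

text \<open>The new boxes are transposes of each other, so exactly one of them lies on or above the
  diagonal.\<close>

lemma half_product_twist:
  assumes "finite (dgm z)"
  shows "half_product (dgm (twist k z)) = weight k (z k) * half_product (dgm z)"
proof -
  let ?H = "\<lambda>D. {(i, j). (i, j) \<in> D \<and> i \<le> (j :: int)}"
  have H: "?H (dgm (twist k z)) = insert (min k (z k), max k (z k)) (?H (dgm z))"
    unfolding dgm_twist by (auto simp: min_def max_def)
  have fin: "finite (?H (dgm z))" by (rule finite_subset[OF _ assms]) auto
  have notin: "(min k (z k), max k (z k)) \<notin> ?H (dgm z)"
    using new_notin by (auto simp: min_def max_def)
  have "weight (min k (z k)) (max k (z k)) = weight k (z k)"
    by (auto simp: min_def max_def weight_def oplus_commute)
  then show ?thesis unfolding half_product_def H using fin notin by simp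
qed

lemma swap_vars_half_product_dgm: "swap_vars k (half_product (dgm z)) = half_product (dgm z)"
  using dgm_sym adj_dgm by (rule swap_vars_half_product)

lemma inv_grothendieck_step:
  assumes "finite (dgm z)" "inv_grothendieck (twist k z) = half_product (dgm (twist k z))"
  shows "inv_grothendieck z = half_product (dgm z)"
proof -
  let ?P = "half_product (dgm z)" and ?x = "X k" and ?y = "X (k + 1)"
  have "\<not> rdesc k z" using asc by (simp add: rdesc_def)
  \<comment> \<open>The twist has a descent at \<open>k\<close>, so its recursion involves
    \<open>z\<close>. As the old half product is symmetric in the two variables, only the new weight
    is changed by the swap.\<close>
  then have "M.U k inv_grothendieck (twist k z) =
      beta * inv_grothendieck (twist k z) + inv_grothendieck z"
    using k z by (simp add: M.U_def twist_Invol rdesc_twist twist_twist)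
  then have rel: "(1 + beta * ?x) * swap_vars k (weight k (z k) * ?P) =
    (1 + beta * ?x) * (weight k (z k) * ?P) +
    (?y - ?x) * (beta * (weight k (z k) * ?P) + inv_grothendieck z)"
    using inv_grothendieck_rel[OF k, of "twist k z"] assms half_product_twist by simp
  have "(?y - ?x) * inv_grothendieck z = (?y - ?x) * ?P"
  proof (cases "z k = k")
    case True
    then have "weight k (z k) = ?x" by (simp add: weight_def)
    then have "(1 + beta * ?x) * (?y * ?P) =
        (1 + beta * ?x) * (?x * ?P) + (?y - ?x) * (beta * (?x * ?P) + inv_grothendieck z)"
      using rel by (simp add: swap_vars_mult swap_vars_half_product_dgm)
    then show ?thesis by (simp add: algebra_simps)
  next
    case False
    let ?c = "X (z k)"
    have "adj k (z k) = z k" using False zk_neq_Suc by (auto simp: adj_apply)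
    then have w: "swap_vars k (weight k (z k)) = oplus ?y ?c" "weight k (z k) = oplus ?x ?c"
      using False by (simp_all add: weight_def oplus_def swap_vars_add swap_vars_mult)
    have "(1 + beta * ?x) * (oplus ?y ?c * ?P) =
        (1 + beta * ?x) * (oplus ?x ?c * ?P) + (?y - ?x) * (beta * (oplus ?x ?c * ?P) + inv_grothendieck z)"
      using rel unfolding swap_vars_mult w(1) unfolding w(2) swap_vars_half_product_dgm .
    then show ?thesis by (simp add: oplus_def algebra_simps)
  qed
  then show ?thesis using X_diff_nonzero[of k] by simp
qed

end

text \<open>Twisting at first ascents adds boxes inside a fixed square, so the induction ends at the
  longest element.\<close>

lemma inv_grothendieck_dominant:
  assumes "1 \<le> n" "z \<in> Invol" "z \<in> S_fin n" "lower_set (dgm z)"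
  shows "inv_grothendieck z = half_product (dgm z)"
  using assms(2-)
proof (induction "card ({1..n} \<times> {1..n}) - card (dgm z)" arbitrary: z rule: less_induct)
  case less
  show ?case
  proof (cases "z = longest n")
    case True
    have "{(i, j). (i, j) \<in> dgm (longest n) \<and> i \<le> j} = {(i, j). 0 < i \<and> i \<le> j \<and> i + j \<le> n}"
      by (auto simp: dgm_longest)
    then show ?thesis
      using inv_grothendieck_longest[OF assms(1)] by (simp add: True half_product_def)
  next
    case False
    obtain k where kn: "0 < k" "k < n" "z k < z (k + 1)"
      "\<And>a b. 0 < a \<Longrightarrow> a < b \<Longrightarrow> b \<le> k \<Longrightarrow> z a > z b"
      using least_ascent[OF less.prems(2) False] by blast
    interpret dominant_ascent z k
      using less.prems kn by unfold_locales
    have fin: "finite (dgm z)" using less.prems finite_dgm by blast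
    have "adj k \<in> S_fin n" using kn by (intro S_fin_adj)
    then have S: "twist k z \<in> S_fin n"
      unfolding twist_def using less.prems(2) by (simp add: S_fin_comp)
    have "card (dgm z) < card (dgm (twist k z))"
      unfolding dgm_twist using fin new_notin by (intro psubset_card_mono) auto
    moreover have "card (dgm (twist k z)) \<le> card ({1..n} \<times> {1..n})"
      using dgm_bounded[OF S] by (intro card_mono) auto
    ultimately have "inv_grothendieck (twist k z) = half_product (dgm (twist k z))"
      using less.prems kn S lower_twist by (intro less.hyps) (auto simp: twist_Invol)
    then show ?thesis using inv_grothendieck_step fin by blast
  qed
qed

lemma partition_antimono:
  assumes "is_partition p" "0 < i'" "i' \<le> i" shows "p i \<le> p i'"
  using assms(3)
proof (induction i rule: int_ge_induct)
  case (step i)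
  then have "p (i + 1) \<le> p i" using assms unfolding is_partition_def by simp
  then show ?case using step by simp
qed simp

lemma lower_set_diagram: "is_partition p \<Longrightarrow> lower_set (diagram p)"
  unfolding lower_set_def diagram_def using partition_antimono by fastforce

theorem theorem3p6:
  fixes z :: "int \<Rightarrow> int" and p :: "int \<Rightarrow> nat"
  assumes "z \<in> S_inf"
    and "z \<circ> z = id"
    and "dominant_of_shape z p"
  shows "inv_grothendieck z =
    (\<Prod>(i, j) \<in> {(i, j). (i, j) \<in> diagram p \<and> i = j}. X i) *
    (\<Prod>(i, j) \<in> {(i, j). (i, j) \<in> diagram p \<and> i < j}. (X i + X j + beta * X i * X j))"
proof -
  let ?E = "{(i, j). (i, j) \<in> diagram p \<and> i = j}" and ?L = "{(i, j). (i, j) \<in> diagram p \<and> i < j}"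
  obtain n where n: "1 \<le> n" "z \<in> S_fin n" using S_inf_in_S_fin assms(1) by blast
  have z: "z \<in> Invol" using assms by (simp add: Invol_def)
  have D: "dgm z = diagram p"
    using assms(3) Invol_inv[OF z] by (simp add: dominant_of_shape_def rothe_diagram_def dgm_def)
  have "inv_grothendieck z = half_product (diagram p)"
    using inv_grothendieck_dominant[OF n(1) z n(2)] lower_set_diagram assms(3)
    by (simp add: D dominant_of_shape_def)
  also have "half_product (diagram p) = (\<Prod>(i, j)\<in>?E \<union> ?L. weight i j)"
    unfolding half_product_def by (rule prod.cong) auto
  also have "\<dots> = (\<Prod>(i, j)\<in>?E. weight i j) * (\<Prod>(i, j)\<in>?L. weight i j)"
  proof (rule prod.union_disjoint)
    have "finite (diagram p)" using finite_dgm[OF n(2)] by (simp add: D)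
    then show "finite ?E" "finite ?L" by (auto elim: rev_finite_subset)
  qed auto
  also have "(\<Prod>(i, j)\<in>?E. weight i j) = (\<Prod>(i, j)\<in>?E. X i)"
    by (rule prod.cong) (auto simp: weight_def)
  also have "(\<Prod>(i, j)\<in>?L. weight i j) = (\<Prod>(i, j)\<in>?L. X i + X j + beta * X i * X j)"
    by (rule prod.cong) (auto simp: weight_def oplus_def)
  finally show ?thesis .
qed

end
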